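(* Let $G$ be a finite simple connected graph with $n$ vertices that is not a tree, with a designated sink vertex. Fix $\varepsilon>0$ and let $\sigma$ be any recurrent state of the sandpile chain on $G$. Let $H_\sigma^t$ and $P_\sigma^t$ denote the distributions at time $t$ of the continuous and discrete time sandpile chains, respectively, started from $\sigma$, and let $U$ be the uniform distribution on recurrent states. Then $$\|H_\sigma^t-U\|_2^2\le\varepsilon\quad\text{for all } t\ge\frac{\pi}{16}\,n\cdot\eta_\varepsilon^2(\Delta\mathbb{Z}^{n-1}),$$ $$\|P_\sigma^t-U\|_2^2\le\varepsilon\quad\text{for all } t\ge\frac{\pi}{16}\,n\cdot\eta_\varepsilon^2(\overline{\Delta}\mathbb{Z}^{n}).$$ Here $\eta_\varepsilon(\cdot)$ is the smoothing parameter, and $\Delta$, $\overline{\Delta}$ are the reduced and full Laplacians of $G$.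
   Context: Let $V=\{v_1,\dots,v_n\}$ with sink $s=v_n$. The full Laplacian $\overline{\Delta}$ is the $n\times n$ matrix with $\overline{\Delta}(i,i)=\deg(v_i)$, $\overline{\Delta}(i,j)=-1$ if $v_i\sim v_j$, $0$ otherwise; the reduced Laplacian $\Delta$ is $\overline{\Delta}$ with the last row and column (the sink) deleted. Sandpile chain: a configuration is $\eta:V\setminus\{s\}\to\mathbb{N}$. It is stable if $\eta(v)<\deg(v)$ for all $v\ne s$. A vertex $v\neq s$ with $\eta(v)\ge\deg(v)$ may topple, losing $\deg(v)$ chips and giving one to each neighbor (chips sent to $s$ vanish). Toppling unstable vertices until none remain gives a stable configuration $\eta^\circ$ independent of the order. Put $\eta\oplus\sigma=(\eta+\sigma)^\circ$ on stable configurations. With $\eta_*(v)=\deg(v)-1$, the set $\mathcal{G}$ of recurrent states consists of all stable configurations of the form $\eta_*\oplus\sigma$ with $\sigma$ stable; it is a finite abelian group under $\oplus$, isomorphic to $\mathbb{Z}^{n-1}/\Delta\mathbb{Z}^{n-1}$ via $\eta\mapsto(\eta(v_1),\dots,\eta(v_{n-1}))+\Delta\mathbb{Z}^{n-1}$. The discrete time sandpile chain on $\mathcal{G}$ moves from $\eta$ to $(\eta+\delta_v)^\circ$ with $v$ uniform in $V$ (all $n$ vertices), where $\delta_v(u)=1\{u=v\}$ and $\delta_s\equiv0$; let $P$ be its transition matrix and $P^t_\sigma=P^t(\sigma,\cdot)$, $t\in\mathbb{N}$. The continuous time chain has kernel $H^t=e^{-t(I-P)}$, and $H^t_\sigma=H^t(\sigma,\cdot)$,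 $t\ge0$ real. $L^2$ distance: $\|\mu-\nu\|_2=\big(|\mathcal{G}|\sum_{g\in\mathcal{G}}|\mu(g)-\nu(g)|^2\big)^{1/2}$. Smoothing parameter: for a lattice $\Lambda\subset\mathbb{R}^m$ (not necessarily of full rank), let $\Lambda^*=\{x\in\mathrm{Span}(\Lambda):\langle x,y\rangle\in\mathbb{Z}\ \text{for all } y\in\Lambda\}$ and $f_\Lambda(r)=\sum_{x\in\Lambda^*\setminus\{0\}}e^{-\pi r^2\|x\|_2^2}$ for $r>0$. $f_\Lambda$ is continuous and strictly decreasing from $\infty$ to $0$, and $\eta_\varepsilon(\Lambda):=f_\Lambda^{-1}(\varepsilon)$. *)

theory Defs
  imports "HOL-Probability.Probability"
begin

text \<open>A graph with a designated sink is an adjacency relation on \<open>'a option\<close> with \<open>'a\<close> finite: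
  the sink is \<open>None\<close> and the vertices other than the sink are the \<open>Some v\<close>. Thus
  \<open>n = CARD('a option)\<close>, the space of real vectors indexed by the non-sink vertices is \<open>real^'a\<close>,
  and configurations are functions on \<open>'a\<close>. Only the one-vertex graph, which is a tree, is not
  covered.\<close>

definition simple_graph :: "('v \<Rightarrow> 'v \<Rightarrow> bool) \<Rightarrow> bool" where
  "simple_graph E \<longleftrightarrow> irreflp E \<and> symp E"

definition graph_connected :: "('v \<Rightarrow> 'v \<Rightarrow> bool) \<Rightarrow> bool" where
  "graph_connected E \<longleftrightarrow> (\<forall>u v. E\<^sup>*\<^sup>* u v)"

definition is_cycle :: "('v \<Rightarrow> 'v \<Rightarrow> bool) \<Rightarrow> 'v list \<Rightarrow> bool" where
  "is_cycle E vs \<longleftrightarrow> length vs \<ge> 3 \<and> distinct vs \<and> successively E vs \<and> E (last vs) (hd vs)"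

definition is_tree :: "('v \<Rightarrow> 'v \<Rightarrow> bool) \<Rightarrow> bool" where
  "is_tree E \<longleftrightarrow> graph_connected E \<and> (\<nexists>vs. is_cycle E vs)"

definition deg :: "('v::finite \<Rightarrow> 'v \<Rightarrow> bool) \<Rightarrow> 'v \<Rightarrow> nat" where
  "deg E v = card {u. E v u}"

definition full_laplacian :: "('v::finite \<Rightarrow> 'v \<Rightarrow> bool) \<Rightarrow> real^'v^'v" where
  "full_laplacian E = (\<chi> i j. if i = j then real (deg E i) else if E i j then -1 else 0)"

definition reduced_laplacian :: "('a::finite option \<Rightarrow> 'a option \<Rightarrow> bool) \<Rightarrow> real^'a^'a" where
  "reduced_laplacian E = (\<chi> i j. full_laplacian E $ Some i $ Some j)"

type_synonym 'a config = "'a \<Rightarrow> nat"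

definition stable :: "('a::finite option \<Rightarrow> 'a option \<Rightarrow> bool) \<Rightarrow> 'a config \<Rightarrow> bool" where
  "stable E \<eta> \<longleftrightarrow> (\<forall>v. \<eta> v < deg E (Some v))"

definition topple :: "('a::finite option \<Rightarrow> 'a option \<Rightarrow> bool) \<Rightarrow> 'a \<Rightarrow> 'a config \<Rightarrow> 'a config" where
  "topple E v \<eta> = (\<lambda>u. if u = v then \<eta> u - deg E (Some v)
                        else if E (Some v) (Some u) then \<eta> u + 1 else \<eta> u)"

definition legal_topple ::
    "('a::finite option \<Rightarrow> 'a option \<Rightarrow> bool) \<Rightarrow> 'a config \<Rightarrow> 'a config \<Rightarrow> bool" where
  "legal_topple E \<eta> \<xi> \<longleftrightarrow> (\<exists>v. \<eta> v \<ge> deg E (Some v) \<and> \<xi> = topple E v \<eta>)"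

definition stabilize :: "('a::finite option \<Rightarrow> 'a option \<Rightarrow> bool) \<Rightarrow> 'a config \<Rightarrow> 'a config" where
  "stabilize E \<eta> = (THE \<xi>. (legal_topple E)\<^sup>*\<^sup>* \<eta> \<xi> \<and> stable E \<xi>)"

definition oplus ::
    "('a::finite option \<Rightarrow> 'a option \<Rightarrow> bool) \<Rightarrow> 'a config \<Rightarrow> 'a config \<Rightarrow> 'a config" where
  "oplus E \<eta> \<sigma> = stabilize E (\<lambda>v. \<eta> v + \<sigma> v)"

definition max_stable :: "('a::finite option \<Rightarrow> 'a option \<Rightarrow> bool) \<Rightarrow> 'a config" where
  "max_stable E = (\<lambda>v. deg E (Some v) - 1)"

definition recurrent :: "('a::finite option \<Rightarrow> 'a option \<Rightarrow> bool) \<Rightarrow> 'a config set" where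
  "recurrent E = {oplus E (max_stable E) \<sigma> |\<sigma>. stable E \<sigma>}"

text \<open>One chip at \<open>v\<close>; the zero configuration if \<open>v\<close> is the sink \<open>None\<close>.\<close>

definition chip :: "'a option \<Rightarrow> 'a config" where
  "chip v = (\<lambda>u. if v = Some u then 1 else 0)"

definition sandpile_P ::
    "('a::finite option \<Rightarrow> 'a option \<Rightarrow> bool) \<Rightarrow> 'a config \<Rightarrow> 'a config \<Rightarrow> real" where
  "sandpile_P E \<eta> \<xi> =
     pmf (map_pmf (\<lambda>v. stabilize E (\<lambda>u. \<eta> u + chip v u)) (pmf_of_set (UNIV :: 'a option set))) \<xi>"

text \<open>Real square matrices with rows and columns indexed by a finite set \<open>S\<close>. Entries outside
  \<open>S \<times> S\<close> are irrelevant.\<close>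

definition mat_one :: "'s \<Rightarrow> 's \<Rightarrow> real" where
  "mat_one x y = (if x = y then 1 else 0)"

fun mat_power :: "'s set \<Rightarrow> ('s \<Rightarrow> 's \<Rightarrow> real) \<Rightarrow> nat \<Rightarrow> 's \<Rightarrow> 's \<Rightarrow> real" where
  "mat_power S K 0 = mat_one"
| "mat_power S K (Suc k) = (\<lambda>x y. \<Sum>z\<in>S. mat_power S K k x z * K z y)"

definition mat_exp :: "'s set \<Rightarrow> ('s \<Rightarrow> 's \<Rightarrow> real) \<Rightarrow> 's \<Rightarrow> 's \<Rightarrow> real" where
  "mat_exp S K x y = (\<Sum>k. mat_power S K k x y / fact k)"

definition discrete_dist ::
    "('a::finite option \<Rightarrow> 'a option \<Rightarrow> bool) \<Rightarrow> nat \<Rightarrow> 'a config \<Rightarrow> 'a config \<Rightarrow> real" where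
  "discrete_dist E t \<sigma> = mat_power (recurrent E) (sandpile_P E) t \<sigma>"

definition continuous_dist ::
    "('a::finite option \<Rightarrow> 'a option \<Rightarrow> bool) \<Rightarrow> real \<Rightarrow> 'a config \<Rightarrow> 'a config \<Rightarrow> real" where
  "continuous_dist E t \<sigma> =
     mat_exp (recurrent E) (\<lambda>\<eta> \<xi>. - t * (mat_one \<eta> \<xi> - sandpile_P E \<eta> \<xi>)) \<sigma>"

definition uniform_dist :: "('a::finite option \<Rightarrow> 'a option \<Rightarrow> bool) \<Rightarrow> 'a config \<Rightarrow> real" where
  "uniform_dist E = pmf (pmf_of_set (recurrent E))"

definition l2_dist :: "'s set \<Rightarrow> ('s \<Rightarrow> real) \<Rightarrow> ('s \<Rightarrow> real) \<Rightarrow> real" where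
  "l2_dist S \<mu> \<nu> = sqrt (real (card S) * (\<Sum>g\<in>S. \<bar>\<mu> g - \<nu> g\<bar>\<^sup>2))"

definition image_lattice :: "real^'m^'k \<Rightarrow> (real^'k) set" where
  "image_lattice A = {A *v z |z. \<forall>i. z $ i \<in> \<int>}"

definition dual_lattice :: "'b::euclidean_space set \<Rightarrow> 'b set" where
  "dual_lattice \<Lambda> = {x \<in> span \<Lambda>. \<forall>y\<in>\<Lambda>. x \<bullet> y \<in> \<int>}"

definition gaussian_sum :: "'b::euclidean_space set \<Rightarrow> real \<Rightarrow> real" where
  "gaussian_sum \<Lambda> r = (\<Sum>\<^sub>\<infinity>x\<in>dual_lattice \<Lambda> - {0}. exp (- pi * r\<^sup>2 * (norm x)\<^sup>2))"

definition smoothing_parameter :: "real \<Rightarrow> 'b::euclidean_space set \<Rightarrow> real" where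
  "smoothing_parameter \<epsilon> \<Lambda> = the_inv_into {0<..} (gaussian_sum \<Lambda>) \<epsilon>"

end

(* The dual group of the sandpile group is (\<Delta>\<int>^(n-1))* / \<int>^(n-1): a point x of the dual lattice
   acts as the character \<eta> \<mapsto> exp(2\<pi>i \<langle>x, \<eta>\<rangle>), which is an eigenfunction of P with eigenvalue
   \<lambda>(x) = (1 + \<Sum>_v exp(2\<pi>i x_v)) / n.  By Parseval the squared distances to uniform are the sums over x \<noteq> 0
   of exp(-2t (1 - Re \<lambda>(x))) and |\<lambda>(x)|^(2t).  Choosing representatives with |x_v| \<le> 1/2, the bound
   1 - cos(2\<pi>y) \<ge> 8y^2 dominates the first sum by the Gaussian sum of \<Delta>\<int>^(n-1).  For the second one the
   sum defining \<lambda>(x) is first rotated by a phase that makes it nonnegative; subtracting the phase from all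
   coordinates (sink included), reducing modulo 1 and projecting to the sum-zero hyperplane maps the
   characters injectively into the dual lattice of the full Laplacian.

   Of the group structure only this is needed: recurrent states that are congruent modulo \<Delta>\<int>^(n-1) are
   equal.  If \<eta> - \<xi> = \<Delta>w with max w > 0, then \<xi> has too few chips on the set where w is maximal, that is,
   \<xi> is forbidden there in the sense of Dhar's burning test, and recurrent states are nowhere forbidden. *)
theory Submission imports Defs "HOL-Library.Confluence" begin

section \<open>Gaussian sums over dual lattices\<close>

lemma summable_on_exp_neg_square_int:
  fixes c :: real
  assumes "c > 0"
  shows "(\<lambda>k::int. exp (- c * (of_int k)\<^sup>2)) summable_on UNIV" (is "?f summable_on _")
proof -
  have nat: "(\<lambda>n::nat. exp (- c * (real n)\<^sup>2)) summable_on UNIV"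
  proof (subst summable_on_UNIV_nonneg_real_iff)
    show "summable (\<lambda>n::nat. exp (- c * (real n)\<^sup>2))"
    proof (rule summable_comparison_test')
      show "summable (\<lambda>n. exp (- c) ^ n)"
        using assms by (intro summable_geometric) auto
      fix n :: nat
      have "real n \<le> (real n)\<^sup>2"
        by (cases n) (auto simp: power2_eq_square)
      hence "exp (- c * (real n)\<^sup>2) \<le> exp (real n * - c)"
        using assms by (simp add: mult.commute)
      thus "norm (exp (- c * (real n)\<^sup>2)) \<le> exp (- c) ^ n"
        by (simp only: exp_of_nat_mult) simp
    qed
  qed auto
  have "?f summable_on range int"
    using nat by (subst summable_on_reindex) (auto simp: o_def)
  moreover have "?f summable_on range (\<lambda>n. - int n)"
    using nat by (subst summable_on_reindex) (auto simp: o_def inj_on_def)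
  ultimately have "?f summable_on range int \<union> (range (\<lambda>n. - int n) - range int)"
    by (intro summable_on_Un_disjoint) (auto intro: summable_on_subset_banach)
  also have "range int \<union> (range (\<lambda>n. - int n) - range int) = UNIV"
  proof (rule UNIV_eq_I[symmetric])
    show "k \<in> range int \<union> (range (\<lambda>n. - int n) - range int)" for k
      by (cases k rule: int_cases2) auto
  qed
  finally show ?thesis .
qed

text \<open>The Gaussian of a vector is the product of the Gaussians of its coordinates, so every
  finite partial sum is bounded by a power of the one-dimensional sum.\<close>

lemma summable_on_exp_neg_norm_integer_vectors:
  fixes c :: real
  assumes "c > 0"
  shows "(\<lambda>z::real^'n. exp (- c * (norm z)\<^sup>2)) summable_on {z. \<forall>i. z $ i \<in> \<int>}"
    (is "?f summable_on ?Z")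
proof (rule nonneg_bdd_above_summable_on)
  let ?g = "\<lambda>k::int. exp (- c * (of_int k)\<^sup>2)"
  show "bdd_above (sum ?f ` {F. F \<subseteq> ?Z \<and> finite F})"
  proof (rule bdd_aboveI2)
    fix F assume "F \<in> {F. F \<subseteq> ?Z \<and> finite F}"
    hence F: "F \<subseteq> ?Z" "finite F" by auto
    define B where "B = (\<lambda>(z, i). \<lfloor>z $ i\<rfloor>) ` (F \<times> UNIV)"
    have B: "finite B" using F by (simp add: B_def)
    define h :: "real^'n \<Rightarrow> 'n \<Rightarrow> int" where "h z = (\<lambda>i. \<lfloor>z $ i\<rfloor>)" for z
    have h: "of_int (h z i) = z $ i" if "z \<in> F" for z i
      using that F by (auto simp: h_def elim!: Ints_cases dest!: subsetD)
    have inj: "inj_on h F"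
      by (rule inj_onI) (metis h vec_eq_iff)
    have "sum ?f F = (\<Sum>z\<in>F. \<Prod>i\<in>UNIV. ?g (h z i))"
      by (intro sum.cong refl)
        (simp add: h norm_vec_def L2_set_def sum_nonneg exp_sum[symmetric] sum_distrib_left sum_negf)
    also have "\<dots> = (\<Sum>g\<in>h ` F. \<Prod>i\<in>UNIV. ?g (g i))"
      by (simp add: sum.reindex[OF inj])
    \<comment> \<open>Enlarging the index set to all functions with values in \<open>B\<close> lets
      the sum of products factor.\<close>
    also have "\<dots> \<le> (\<Sum>g\<in>PiE (UNIV::'n set) (\<lambda>_. B). \<Prod>i\<in>UNIV. ?g (g i))"
      by (rule sum_mono2) (auto simp: B_def h_def F(2) intro!: finite_PiE prod_nonneg)
    also have "\<dots> = (\<Prod>i\<in>(UNIV::'n set). \<Sum>k\<in>B. ?g k)"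
      using B by (subst prod_sum_PiE) auto
    also have "\<dots> \<le> (\<Prod>i\<in>(UNIV::'n set). infsum ?g UNIV)"
      using B by (intro prod_mono conjI sum_nonneg finite_sum_le_infsum
          summable_on_exp_neg_square_int assms) auto
    finally show "sum ?f F \<le> (\<Prod>i\<in>(UNIV::'n set). infsum ?g UNIV)" .
  qed
qed auto

lemma span_image_lattice: "span (image_lattice A) = range ((*v) A)"
proof
  show "span (image_lattice A) \<subseteq> range ((*v) A)"
    by (intro span_minimal linear_subspace_image)
      (auto simp: image_lattice_def matrix_vector_mul_linear)
  show "range ((*v) A) \<subseteq> span (image_lattice A)"
  proof clarify
    fix x
    have "column i A \<in> image_lattice A" for i
      unfolding image_lattice_def mem_Collect_eq
      by (rule exI[of _ "axis i 1"]) (auto simp: matrix_vector_mult_basis, auto simp: axis_def)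
    thus "A *v x \<in> span (image_lattice A)"
      by (auto simp: matrix_mult_sum scalar_mult_eq_scaleR intro!: span_sum intro: span_scale span_base)
  qed
qed

text \<open>Pairing \<open>x\<close> with \<open>A *v z\<close> is pairing \<open>x v* A\<close>
  with \<open>z\<close>, so it suffices to test the unit vectors \<open>z\<close>.\<close>

lemma dual_lattice_image_lattice:
  "dual_lattice (image_lattice A) = {x \<in> range ((*v) A). \<forall>i. (x v* A) $ i \<in> \<int>}"
proof -
  have "(\<forall>y\<in>image_lattice A. x \<bullet> y \<in> \<int>) \<longleftrightarrow> (\<forall>i. (x v* A) $ i \<in> \<int>)" for x
  proof
    assume *: "\<forall>y\<in>image_lattice A. x \<bullet> y \<in> \<int>"
    show "\<forall>i. (x v* A) $ i \<in> \<int>"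
    proof
      fix i
      have "A *v axis i 1 \<in> image_lattice A"
        by (auto simp: image_lattice_def axis_def)
      hence "x \<bullet> (A *v axis i 1) \<in> \<int>" using * by blast
      thus "(x v* A) $ i \<in> \<int>"
        by (simp add: dot_lmul_matrix[symmetric] inner_axis)
    qed
  next
    assume *: "\<forall>i. (x v* A) $ i \<in> \<int>"
    show "\<forall>y\<in>image_lattice A. x \<bullet> y \<in> \<int>"
      using * by (auto simp: image_lattice_def dot_lmul_matrix[symmetric], auto simp: inner_vec_def)
  qed
  thus ?thesis by (auto simp: dual_lattice_def span_image_lattice)
qed

text \<open>The map \<open>x \<mapsto> x v* A\<close> sends the dual lattice injectively to integer
  vectors and enlarges norms by at most the factor \<open>K\<close>, so a Gaussian sum over integer
  vectors dominates.\<close>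

lemma gaussian_summable_on_dual_image_lattice:
  assumes "r > 0"
  shows "(\<lambda>x. exp (- pi * r\<^sup>2 * (norm x)\<^sup>2)) summable_on dual_lattice (image_lattice A)"
    (is "?f summable_on ?D")
proof -
  obtain K where K: "K > 0" "norm (x v* A) \<le> norm x * K" for x
    using bounded_linear.pos_bounded[OF matrix_vector_mul_bounded_linear, of "transpose A"] 
    by auto
  define c where "c = pi * r\<^sup>2 / K\<^sup>2"
  have c: "c > 0" using assms K by (simp add: c_def)
  have inj: "inj_on (\<lambda>x. x v* A) ?D"
  proof (rule inj_onI)
    fix x y assume "x \<in> ?D" "y \<in> ?D" and eq: "x v* A = y v* A"
    then obtain u v where uv: "x = A *v u" "y = A *v v"
      by (auto simp: dual_lattice_image_lattice)
    \<comment> \<open>\<open>x - y\<close> lies in the range of \<open>A\<close> and is orthogonal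
      to it.\<close>
    have "(x - y) \<bullet> (x - y) = (x - y) \<bullet> (A *v (u - v))"
      by (simp add: uv matrix_vector_mult_diff_distrib)
    also have "\<dots> = ((x - y) v* A) \<bullet> (u - v)"
      by (simp add: dot_lmul_matrix)
    also have "(x - y) v* A = 0"
      using eq by (metis matrix_vector_mult_diff_distrib transpose_matrix_vector eq_iff_diff_eq_0)
    finally show "x = y" by simp
  qed
  have "(\<lambda>z. exp (- c * (norm z)\<^sup>2)) summable_on (\<lambda>x. x v* A) ` ?D"
    by (rule summable_on_subset_banach[OF summable_on_exp_neg_norm_integer_vectors[OF c]])
      (auto simp: dual_lattice_image_lattice)
  hence "(\<lambda>x. exp (- c * (norm (x v* A))\<^sup>2)) summable_on ?D"
    using inj by (simp add: summable_on_reindex o_def)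
  thus ?thesis
  proof (rule summable_on_comparison_test)
    fix x
    have "(norm (x v* A))\<^sup>2 \<le> (norm x * K)\<^sup>2"
      using K by (intro power_mono) auto
    hence "c * (norm (x v* A))\<^sup>2 \<le> c * (norm x * K)\<^sup>2"
      using c by (intro mult_left_mono) auto
    also have "\<dots> = pi * r\<^sup>2 * (norm x)\<^sup>2"
      using K(1) by (simp add: c_def field_simps power_mult_distrib)
    finally show "?f x \<le> exp (- c * (norm (x v* A))\<^sup>2)" by simp
  qed auto
qed

section \<open>The Gaussian sum as a function of \<open>r\<close>: continuity, monotonicity and
  range\<close>

context
  fixes \<Lambda> :: "'b::euclidean_space set"
  assumes summable: "\<And>r. r > 0 \<Longrightarrow>
    (\<lambda>x. exp (- pi * r\<^sup>2 * (norm x)\<^sup>2)) summable_on dual_lattice \<Lambda> - {0}"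
begin

text \<open>On \<open>{a..}\<close> the summands at \<open>r = a\<close> serve as majorants in the
  Weierstrass test. Uniform convergence gives both continuity and the limit at infinity.\<close>

lemma uniform_limit_gaussian_sum:
  assumes "a > 0"
  shows "uniform_limit {a..} (\<lambda>X r. \<Sum>x\<in>X. exp (- pi * r\<^sup>2 * (norm x)\<^sup>2)) (gaussian_sum \<Lambda>)
    (finite_subsets_at_top (dual_lattice \<Lambda> - {0}))"
  unfolding gaussian_sum_def
proof (rule Weierstrass_m_test_general)
  show "(\<lambda>x. exp (- pi * a\<^sup>2 * (norm x)\<^sup>2)) summable_on dual_lattice \<Lambda> - {0}"
    using assms by (rule summable)
  fix x r assume "r \<in> {a..}"
  hence "a\<^sup>2 \<le> r\<^sup>2" using assms by (intro power_mono) auto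
  hence "a\<^sup>2 * (norm x)\<^sup>2 \<le> r\<^sup>2 * (norm x)\<^sup>2" by (intro mult_right_mono) auto
  thus "norm (exp (- pi * r\<^sup>2 * (norm x)\<^sup>2)) \<le> exp (- pi * a\<^sup>2 * (norm x)\<^sup>2)"
    by (simp add: mult.assoc)
qed

lemma continuous_on_gaussian_sum: "a > 0 \<Longrightarrow> continuous_on {a..} (gaussian_sum \<Lambda>)"
  by (rule uniform_limit_theorem[OF _ uniform_limit_gaussian_sum])
    (auto intro!: always_eventually continuous_intros)

lemma gaussian_sum_tendsto_0: "(gaussian_sum \<Lambda> \<longlongrightarrow> 0) at_top"
proof (rule swap_uniform_limit'[OF _ _ uniform_limit_gaussian_sum[of 1]])
  show "\<forall>\<^sub>F X in finite_subsets_at_top (dual_lattice \<Lambda> - {0}).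
    ((\<lambda>r. \<Sum>x\<in>X. exp (- pi * r\<^sup>2 * (norm x)\<^sup>2)) \<longlongrightarrow> 0) at_top"
  proof (rule eventually_finite_subsets_at_top_weakI, intro tendsto_null_sum)
    fix X x assume "X \<subseteq> dual_lattice \<Lambda> - {0}" "x \<in> X"
    hence "x \<noteq> 0" by blast
    hence x: "pi * (norm x)\<^sup>2 > 0" by simp
    have "filterlim (\<lambda>r::real. pi * (norm x)\<^sup>2 * r\<^sup>2) at_top at_top"
      by (intro filterlim_tendsto_pos_mult_at_top[OF tendsto_const x] filterlim_pow_at_top filterlim_ident) auto
    hence "((\<lambda>r. exp (- (pi * (norm x)\<^sup>2 * r\<^sup>2))) \<longlongrightarrow> 0) at_top"
      by (intro filterlim_compose[OF exp_at_bot] filterlim_compose[OF filterlim_uminus_at_bot_at_top])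
    thus "((\<lambda>r. exp (- pi * r\<^sup>2 * (norm x)\<^sup>2)) \<longlongrightarrow> 0) at_top"
      by (simp add: mult_ac)
  qed
qed (auto simp: eventually_ge_at_top)

lemma gaussian_sum_strict_antimono:
  assumes "x \<in> dual_lattice \<Lambda>" "x \<noteq> 0" "0 < r" "r < s"
  shows "gaussian_sum \<Lambda> s < gaussian_sum \<Lambda> r"
  unfolding gaussian_sum_def
proof (rule has_sum_strict_mono[OF has_sum_infsum has_sum_infsum])
  have rs: "r\<^sup>2 < s\<^sup>2" using assms by (simp add: power_strict_mono)
  show "exp (- pi * s\<^sup>2 * (norm x)\<^sup>2) < exp (- pi * r\<^sup>2 * (norm x)\<^sup>2)"
    using rs assms by simp
  show "exp (- pi * s\<^sup>2 * (norm x)\<^sup>2) \<le> exp (- pi * r\<^sup>2 * (norm x)\<^sup>2)" for x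
    using rs by (simp add: mult_right_mono mult_left_mono)
qed (use assms summable in auto)

text \<open>All positive multiples of \<open>x\<close> lie in the dual lattice, and as
  \<open>r\<close> tends to 0 each of the first \<open>M\<close> of them contributes nearly
  1.\<close>

lemma gaussian_sum_large:
  assumes "x \<in> dual_lattice \<Lambda>" "x \<noteq> 0"
  obtains r where "r > 0" "C \<le> gaussian_sum \<Lambda> r"
proof -
  define M where "M = nat \<lceil>C\<rceil> * 2 + 1"
  \<comment> \<open>\<open>Suc k\<close> rather than \<open>k\<close> keeps the origin out.\<close>
  define X where "X = (\<lambda>k. real (Suc k) *\<^sub>R x) ` {..<M}"
  have inj: "inj_on (\<lambda>k. real (Suc k) *\<^sub>R x) {..<M}"
    using assms by (auto simp: inj_on_def)
  have sub: "X \<subseteq> dual_lattice \<Lambda> - {0}"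
    using assms by (auto simp: X_def dual_lattice_def span_scale simp del: of_nat_Suc)
  have "((\<lambda>r::real. \<Sum>y\<in>X. exp (- pi * r\<^sup>2 * (norm y)\<^sup>2)) \<longlongrightarrow> (\<Sum>y\<in>X. exp (- pi * 0\<^sup>2 * (norm y)\<^sup>2)))
      (at_right 0)"
    by (intro tendsto_intros)
  also have "(\<Sum>y\<in>X. exp (- pi * 0\<^sup>2 * (norm y)\<^sup>2)) = real M"
    using inj by (simp add: X_def card_image)
  finally have "\<forall>\<^sub>F r in at_right 0. C < (\<Sum>y\<in>X. exp (- pi * r\<^sup>2 * (norm y)\<^sup>2))"
    by (rule order_tendstoD) (simp add: M_def, linarith)
  hence "\<forall>\<^sub>F r in at_right 0. C < (\<Sum>y\<in>X. exp (- pi * r\<^sup>2 * (norm y)\<^sup>2)) \<and> 0 < r"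
    using eventually_at_right_less by (rule eventually_conj)
  from eventually_happens'[OF trivial_limit_at_right_real this]
  obtain r where r: "C < (\<Sum>y\<in>X. exp (- pi * r\<^sup>2 * (norm y)\<^sup>2))" "0 < r" by blast
  note r(1)
  also have "(\<Sum>y\<in>X. exp (- pi * r\<^sup>2 * (norm y)\<^sup>2)) \<le> gaussian_sum \<Lambda> r"
    unfolding gaussian_sum_def
    by (rule finite_sum_le_infsum[OF summable[OF r(2)] _ sub]) (auto simp: X_def)
  finally show thesis using r(2) that by auto
qed

text \<open>A nonzero dual vector makes the sum strictly decreasing with arbitrarily large values,
  and the intermediate value theorem supplies a preimage of \<open>\<epsilon>\<close>; thus
  \<open>the_inv_into\<close> returns a genuine value.\<close>

lemma smoothing_parameter:
  assumes "x \<in> dual_lattice \<Lambda>" "x \<noteq> 0" "\<epsilon> > 0"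
  shows "smoothing_parameter \<epsilon> \<Lambda> > 0" "gaussian_sum \<Lambda> (smoothing_parameter \<epsilon> \<Lambda>) = \<epsilon>"
proof -
  have inj: "inj_on (gaussian_sum \<Lambda>) {0<..}"
    using gaussian_sum_strict_antimono[OF assms(1,2)]
    by (intro linorder_inj_onI') fastforce
  obtain a where a: "a > 0" "\<epsilon> \<le> gaussian_sum \<Lambda> a"
    using gaussian_sum_large assms by blast
  have "\<forall>\<^sub>F r in at_top. gaussian_sum \<Lambda> r < \<epsilon> \<and> a \<le> r"
    using order_tendstoD(2)[OF gaussian_sum_tendsto_0 assms(3)] eventually_ge_at_top
    by (rule eventually_conj)
  from eventually_happens'[OF trivial_limit_at_top_linorder this]
  obtain b where b: "gaussian_sum \<Lambda> b < \<epsilon>" "a \<le> b" by blast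
  have "\<exists>r\<ge>a. r \<le> b \<and> gaussian_sum \<Lambda> r = \<epsilon>"
    using a b continuous_on_subset[OF continuous_on_gaussian_sum[OF a(1)], of "{a..b}"]
    by (intro IVT2') auto
  then obtain r where "r \<ge> a" "gaussian_sum \<Lambda> r = \<epsilon>" by blast
  hence "\<epsilon> \<in> gaussian_sum \<Lambda> ` {0<..}" using a by (intro image_eqI[of _ _ r]) auto
  thus "smoothing_parameter \<epsilon> \<Lambda> > 0" "gaussian_sum \<Lambda> (smoothing_parameter \<epsilon> \<Lambda>) = \<epsilon>"
    unfolding smoothing_parameter_def
    using the_inv_into_into[OF inj _ subset_refl] f_the_inv_into_f[OF inj] by simp_all
qed

end

section \<open>Stabilization and recurrent states\<close>

text \<open>Written as a sum of edge differences, the form in which the maximum principle and the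
  cancellation along edges are visible.\<close>

definition laplacian :: "('v::finite \<Rightarrow> 'v \<Rightarrow> bool) \<Rightarrow> ('v \<Rightarrow> real) \<Rightarrow> 'v \<Rightarrow> real" where
  "laplacian E w v = (\<Sum>u | E v u. w v - w u)"

text \<open>In Dhar's burning test no vertex of such a set ever burns; the sink burns first, hence
  \<open>S\<close> consists of other vertices only.\<close>

definition forbidden :: "('a::finite option \<Rightarrow> 'a option \<Rightarrow> bool) \<Rightarrow> 'a config \<Rightarrow> 'a set \<Rightarrow> bool" where
  "forbidden E \<eta> S \<longleftrightarrow> S \<noteq> {} \<and> (\<forall>v\<in>S. \<eta> v < card {u\<in>S. E (Some v) (Some u)})"

section \<open>Laplacians of a connected graph and the maximum principle\<close>

locale sandpile_graph =
  fixes E :: "'a::finite option \<Rightarrow> 'a option \<Rightarrow> bool"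
  assumes simple: "simple_graph E" and connected: "graph_connected E"
begin

lemma edge_irrefl [simp]: "\<not> E v v"
  using simple by (auto simp: simple_graph_def irreflp_def)

lemma edge_commute: "E u v \<longleftrightarrow> E v u"
  using simple by (auto simp: simple_graph_def symp_def)

lemma closed_set_contains:
  assumes "v \<in> S" "\<And>u w. u \<in> S \<Longrightarrow> E u w \<Longrightarrow> w \<in> S"
  shows "w \<in> S"
proof -
  have "E\<^sup>*\<^sup>* v w" using connected by (auto simp: graph_connected_def)
  thus ?thesis by (induction rule: rtranclp_induct) (use assms in auto)
qed

lemma full_laplacian_mult: "(full_laplacian E *v x) $ v = laplacian E (($) x) v"
proof -
  have "(full_laplacian E *v x) $ v = (\<Sum>u\<in>UNIV. (if u = v then deg E v * x $ v else 0)
      - (if E v u then x $ u else 0))"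
    unfolding full_laplacian_def matrix_vector_mult_def by (auto intro!: sum.cong)
  also have "\<dots> = deg E v * x $ v - (\<Sum>u | E v u. x $ u)"
    by (simp add: sum_subtractf sum.If_cases)
  also have "\<dots> = laplacian E (($) x) v"
    by (simp add: laplacian_def sum_subtractf deg_def)
  finally show ?thesis .
qed

lemma sum_option: "(\<Sum>v\<in>UNIV. f v) = f None + (\<Sum>v\<in>UNIV. f (Some v))"
  for f :: "'a option \<Rightarrow> 'b::comm_monoid_add"
  by (simp add: UNIV_option_conv sum.reindex)

text \<open>Deleting the column of the sink amounts to extending vectors by 0 there; this lets
  statements about functions on all vertices be used for the reduced Laplacian.\<close>

lemma reduced_laplacian_mult:
  "(reduced_laplacian E *v x) $ v = laplacian E (case_option 0 (($) x)) (Some v)"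
proof -
  have "(reduced_laplacian E *v x) $ v
      = (full_laplacian E *v (\<chi> u. case_option 0 (($) x) u)) $ Some v"
    by (simp add: matrix_vector_mult_def sum_option reduced_laplacian_def)
  moreover have "(($) (\<chi> u. case_option 0 (($) x) u)) = case_option 0 (($) x)" by auto
  ultimately show ?thesis by (simp only: full_laplacian_mult)
qed

text \<open>Every edge occurs once in each direction, with opposite differences.\<close>

lemma sum_laplacian: "(\<Sum>v\<in>UNIV. laplacian E w v) = 0"
proof -
  let ?S = "\<Sum>v\<in>UNIV. \<Sum>u\<in>UNIV. if E v u then w v - w u else 0"
  have "?S = (\<Sum>v\<in>UNIV. \<Sum>u\<in>UNIV. if E u v then w u - w v else 0)"
    by (rule sum.swap)
  also have "\<dots> = - ?S"
    unfolding sum_negf[symmetric] by (intro sum.cong refl) (auto simp: edge_commute)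
  finally show ?thesis by (simp add: laplacian_def sum.If_cases)
qed

lemma vector_full_laplacian: "x v* full_laplacian E = full_laplacian E *v x"
  unfolding matrix_vector_mult_def vector_matrix_mult_def full_laplacian_def
  by (intro arg_cong[of _ _ vec_lambda] ext sum.cong) (auto simp: edge_commute)

lemma vector_reduced_laplacian: "x v* reduced_laplacian E = reduced_laplacian E *v x"
  unfolding matrix_vector_mult_def vector_matrix_mult_def reduced_laplacian_def full_laplacian_def
  by (intro arg_cong[of _ _ vec_lambda] ext sum.cong) (auto simp: edge_commute)

text \<open>Where a positive maximum is attained all edge differences are nonnegative with sum at
  most 0, so the neighbours attain it too. Connectedness carries it to \<open>s\<close>, where
  \<open>w\<close> is not positive.\<close>

lemma maximum_principle:
  assumes "w s \<le> 0" and "\<And>v. v \<noteq> s \<Longrightarrow> 0 < w v \<Longrightarrow> laplacian E w v \<le> 0"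
  shows "w v \<le> 0"
proof (rule ccontr)
  assume v: "\<not> w v \<le> 0"
  define M where "M = Max (range w)"
  have M: "w u \<le> M" for u by (simp add: M_def)
  have pos: "M > 0" using v M[of v] by simp
  have "M \<in> range w" unfolding M_def by (intro Max_in) auto
  then obtain v0 where v0: "w v0 = M" by auto
  have "s \<in> {v. w v = M}"
  proof (rule closed_set_contains)
    show "v0 \<in> {v. w v = M}" using v0 by simp
    fix u u' assume u: "u \<in> {v. w v = M}" "E u u'"
    hence "laplacian E w u \<le> 0" using assms pos by (cases "u = s") auto
    moreover have "w u - w u' \<le> laplacian E w u"
      unfolding laplacian_def using u M by (intro member_le_sum) auto
    ultimately show "u' \<in> {v. w v = M}" using u M[of u'] by simp
  qed
  thus False using pos assms(1) by simp
qed

text \<open>The maximum principle applies to a kernel vector and to its negative.\<close>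

lemma invertible_reduced_laplacian: "invertible (reduced_laplacian E)"
proof -
  have "x $ v \<le> 0" if "reduced_laplacian E *v x = 0" for x v
  proof -
    have "case_option 0 (($) x) (Some v) \<le> 0"
    proof (rule maximum_principle[of _ None])
      fix u assume "u \<noteq> (None :: 'a option)"
      thus "laplacian E (case_option 0 (($) x)) u \<le> 0"
        using that by (cases u) (auto simp: reduced_laplacian_mult[symmetric])
    qed simp
    thus ?thesis by simp
  qed
  note nonpos = this
  have "x = 0" if x: "reduced_laplacian E *v x = 0" for x
  proof -
    have "reduced_laplacian E *v (- x) = 0"
      using x by (simp add: linear_neg[OF matrix_vector_mul_linear])
    from nonpos[OF this] nonpos[OF x] show ?thesis
      by (simp add: vec_eq_iff order_antisym)
  qed
  hence "inj ((*v) (reduced_laplacian E))"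
    by (intro linear_injective_0[THEN iffD2] matrix_vector_mul_linear allI impI)
  thus ?thesis by (simp add: invertible_left_inverse matrix_left_invertible_injective)
qed

lemma matrix_inv_reduced_laplacian:
  "reduced_laplacian E ** matrix_inv (reduced_laplacian E) = mat 1"
  "matrix_inv (reduced_laplacian E) ** reduced_laplacian E = mat 1"
  using someI_ex[OF invertible_reduced_laplacian[unfolded invertible_def]]
  by (simp_all add: matrix_inv_def)

lemma reduced_laplacian_inverse:
  "reduced_laplacian E *v (matrix_inv (reduced_laplacian E) *v x) = x"
  by (simp add: matrix_vector_mul_assoc matrix_inv_reduced_laplacian)

lemma reduced_laplacian_inverse':
  "matrix_inv (reduced_laplacian E) *v (reduced_laplacian E *v x) = x"
  by (simp add: matrix_vector_mul_assoc matrix_inv_reduced_laplacian)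

lemma reduced_laplacian_self_adjoint:
  "(reduced_laplacian E *v x) \<bullet> y = x \<bullet> (reduced_laplacian E *v y)"
  by (metis dot_lmul_matrix vector_reduced_laplacian)

section \<open>Toppling, termination and uniqueness of the stabilization\<close>

definition config_vec :: "'a config \<Rightarrow> real^'a" where
  "config_vec \<eta> = (\<chi> v. real (\<eta> v))"

lemma config_vec_topple:
  assumes "deg E (Some v) \<le> \<eta> v"
  shows "config_vec (topple E v \<eta>) = config_vec \<eta> - reduced_laplacian E $ v"
  using assms by (auto simp: config_vec_def topple_def vec_eq_iff reduced_laplacian_def
      full_laplacian_def of_nat_diff)

text \<open>Toppling subtracts a row of the Laplacian. This is used with integral
  \<open>reduced_laplacian E *v x\<close>, where pairings are invariant modulo 1, and with the
  all-ones vector, where they strictly drop.\<close>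

lemma inner_config_vec_topple:
  assumes "deg E (Some v) \<le> \<eta> v"
  shows "x \<bullet> config_vec (topple E v \<eta>) = x \<bullet> config_vec \<eta> - (reduced_laplacian E *v x) $ v"
  by (simp add: config_vec_topple[of v \<eta>, OF assms] inner_diff_right matrix_mult_dot row_def inner_commute)

lemma inner_config_vec_legal_topple:
  assumes "(legal_topple E)\<^sup>*\<^sup>* \<eta> \<xi>" "\<And>v. (reduced_laplacian E *v x) $ v \<in> \<int>"
  shows "x \<bullet> config_vec \<eta> - x \<bullet> config_vec \<xi> \<in> \<int>"
  using assms(1)
proof (induction rule: rtranclp_induct)
  case (step \<xi> \<zeta>)
  then obtain v where "deg E (Some v) \<le> \<xi> v" "\<zeta> = topple E v \<xi>"
    by (auto simp: legal_topple_def)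
  hence "x \<bullet> config_vec \<eta> - x \<bullet> config_vec \<zeta>
      = (x \<bullet> config_vec \<eta> - x \<bullet> config_vec \<xi>) + (reduced_laplacian E *v x) $ v"
    by (simp add: inner_config_vec_topple)
  thus ?case using step.IH assms(2) by (simp only: Ints_add)
qed auto

lemma ex_stabilization: "\<exists>\<xi>. (legal_topple E)\<^sup>*\<^sup>* \<eta> \<xi> \<and> stable E \<xi>"
proof -
  \<comment> \<open>The weight \<open>\<Delta>\<^sup>-\<^sup>1 1 \<ge> 0\<close> makes the weighted number of chips drop by one at each toppling.\<close>
  define \<phi> where "\<phi> = matrix_inv (reduced_laplacian E) *v 1"
  have \<phi>: "(reduced_laplacian E *v \<phi>) $ v = 1" for v
    by (simp add: \<phi>_def reduced_laplacian_inverse)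
  have nonneg: "\<phi> $ v \<ge> 0" for v
  proof -
    have "- case_option 0 (($) \<phi>) (Some v) \<le> 0"
    proof (rule maximum_principle[of _ None])
      fix u assume "u \<noteq> (None :: 'a option)"
      then obtain a where [simp]: "u = Some a" by auto
      have "laplacian E (\<lambda>v. - case_option 0 (($) \<phi>) v) u = - (reduced_laplacian E *v \<phi>) $ a"
        by (simp add: reduced_laplacian_mult laplacian_def sum_negf[symmetric])
      thus "laplacian E (\<lambda>v. - case_option 0 (($) \<phi>) v) u \<le> 0" using \<phi> by simp
    qed simp
    thus ?thesis by simp
  qed
  have pos: "\<phi> \<bullet> config_vec \<xi> \<ge> 0" for \<xi>
    using nonneg by (auto simp: inner_vec_def config_vec_def intro!: sum_nonneg)
  show ?thesis
  \<comment> \<open>The floor turns the real weight into a natural measure. It decreases strictly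
    because the weight is still nonnegative after dropping by 1.\<close>
  proof (induction "nat \<lfloor>\<phi> \<bullet> config_vec \<eta>\<rfloor>" arbitrary: \<eta> rule: less_induct)
    case less
    show ?case
    proof (cases "stable E \<eta>")
      case False
      then obtain v where v: "deg E (Some v) \<le> \<eta> v" by (auto simp: stable_def not_less)
      have "\<phi> \<bullet> config_vec (topple E v \<eta>) = \<phi> \<bullet> config_vec \<eta> - 1"
        using inner_config_vec_topple[of v \<eta>, OF v] \<phi> by simp
      hence "nat \<lfloor>\<phi> \<bullet> config_vec (topple E v \<eta>)\<rfloor> < nat \<lfloor>\<phi> \<bullet> config_vec \<eta>\<rfloor>"
        using pos[of "topple E v \<eta>"] by linarith
      from less[OF this] v show ?thesis
        by (meson converse_rtranclp_into_rtranclp legal_topple_def)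
    qed auto
  qed
qed

text \<open>Topplings at two different vertices commute: each only adds chips at the other vertex,
  so the other toppling stays legal.\<close>

lemma confluentp_legal_topple: "confluentp (legal_topple E)"
proof (rule strong_confluentp_imp_confluentp, rule strong_confluentpI)
  fix \<eta> \<xi> \<zeta> assume "legal_topple E \<eta> \<xi>" "legal_topple E \<eta> \<zeta>"
  then obtain v w where vw: "deg E (Some v) \<le> \<eta> v" "\<xi> = topple E v \<eta>"
      "deg E (Some w) \<le> \<eta> w" "\<zeta> = topple E w \<eta>"
    by (auto simp: legal_topple_def)
  show "\<exists>\<theta>. (legal_topple E)\<^sup>*\<^sup>* \<xi> \<theta> \<and> (legal_topple E)\<^sup>=\<^sup>= \<zeta> \<theta>"
  proof (cases "v = w")
    case False
    hence "deg E (Some w) \<le> \<xi> w" "deg E (Some v) \<le> \<zeta> v"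
      using vw by (auto simp: topple_def)
    moreover have "topple E w \<xi> = topple E v \<zeta>"
      using vw False by (auto simp: topple_def fun_eq_iff)
    ultimately show ?thesis
      by (metis legal_topple_def r_into_rtranclp sup2CI)
  qed (use vw in auto)
qed

lemma stable_legal_topple:
  assumes "(legal_topple E)\<^sup>*\<^sup>* \<eta> \<xi>" "stable E \<eta>"
  shows "\<xi> = \<eta>"
  using assms by (induction rule: converse_rtranclp_induct)
    (auto simp: legal_topple_def stable_def not_le[symmetric])

lemma stabilize_eqI:
  assumes "(legal_topple E)\<^sup>*\<^sup>* \<eta> \<xi>" "stable E \<xi>"
  shows "stabilize E \<eta> = \<xi>"
  unfolding stabilize_def
proof (rule the_equality)
  fix \<xi>' assume "(legal_topple E)\<^sup>*\<^sup>* \<eta> \<xi>' \<and> stable E \<xi>'"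
  with assms show "\<xi>' = \<xi>"
    by (metis confluentpD[OF confluentp_legal_topple] stable_legal_topple)
qed (use assms in auto)

lemma legal_topple_stabilize: "(legal_topple E)\<^sup>*\<^sup>* \<eta> (stabilize E \<eta>)"
  and stable_stabilize: "stable E (stabilize E \<eta>)"
  using ex_stabilization[of \<eta>] stabilize_eqI by auto

lemma legal_topple_add:
  assumes "(legal_topple E)\<^sup>*\<^sup>* \<eta> \<xi>"
  shows "(legal_topple E)\<^sup>*\<^sup>* (\<lambda>v. \<eta> v + \<zeta> v) (\<lambda>v. \<xi> v + \<zeta> v)"
  using assms
proof (induction rule: rtranclp_induct)
  case (step \<xi> \<xi>')
  then obtain v where v: "deg E (Some v) \<le> \<xi> v" "\<xi>' = topple E v \<xi>"
    by (auto simp: legal_topple_def)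
  hence "(\<lambda>u. \<xi>' u + \<zeta> u) = topple E v (\<lambda>u. \<xi> u + \<zeta> u)"
    by (auto simp: topple_def)
  hence "legal_topple E (\<lambda>u. \<xi> u + \<zeta> u) (\<lambda>u. \<xi>' u + \<zeta> u)"
    using v by (auto simp: legal_topple_def intro: trans_le_add1)
  with step.IH show ?case by simp
qed auto

text \<open>Topplings of \<open>\<eta>\<close> stay legal in the presence of the extra chips
  \<open>\<zeta>\<close>, so stabilizing \<open>\<eta>\<close> first is a partial stabilization of
  the sum.\<close>

lemma stabilize_add_stabilize:
  "stabilize E (\<lambda>v. stabilize E \<eta> v + \<zeta> v) = stabilize E (\<lambda>v. \<eta> v + \<zeta> v)"
  by (rule stabilize_eqI[symmetric])
    (blast intro: rtranclp_trans legal_topple_add legal_topple_stabilize stable_stabilize)+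

section \<open>Recurrent states, forbidden sets and uniqueness in a class modulo the lattice\<close>

lemma recurrent_add_chip:
  assumes "\<eta> \<in> recurrent E"
  shows "stabilize E (\<lambda>u. \<eta> u + chip v u) \<in> recurrent E"
proof -
  obtain \<sigma> where \<sigma>: "\<eta> = stabilize E (\<lambda>u. max_stable E u + \<sigma> u)"
    using assms by (auto simp: recurrent_def oplus_def)
  \<comment> \<open>The new chip is absorbed into the summand \<open>\<sigma>\<close>, which is
    stabilized again to be admissible in the definition of \<open>recurrent\<close>.\<close>
  define \<tau> where "\<tau> = stabilize E (\<lambda>u. \<sigma> u + chip v u)"
  have "stabilize E (\<lambda>u. \<eta> u + chip v u) = stabilize E (\<lambda>u. \<sigma> u + chip v u + max_stable E u)"
    unfolding \<sigma> stabilize_add_stabilize by (simp add: add_ac)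
  also have "\<dots> = oplus E (max_stable E) \<tau>"
    using stabilize_add_stabilize[of "\<lambda>u. \<sigma> u + chip v u" "max_stable E"]
    by (simp add: \<tau>_def oplus_def add.commute)
  finally show ?thesis
    unfolding recurrent_def \<tau>_def using stable_stabilize by blast
qed

lemma stable_recurrent: "\<eta> \<in> recurrent E \<Longrightarrow> stable E \<eta>"
  by (auto simp: recurrent_def oplus_def stable_stabilize)

lemma finite_recurrent: "finite (recurrent E)"
proof (rule finite_subset)
  show "recurrent E \<subseteq> PiE UNIV (\<lambda>v. {..<deg E (Some v)})"
    using stable_recurrent by (auto simp: stable_def)
qed (auto intro: finite_PiE)

text \<open>A vertex with one chip less than its degree would need all its neighbours in
  \<open>S\<close>. Then \<open>S\<close> is closed under edges and would contain the sink.\<close>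

lemma not_forbidden_max_stable: "\<not> forbidden E (max_stable E) S"
proof
  assume S: "forbidden E (max_stable E) S"
  then obtain v where v: "v \<in> S" by (auto simp: forbidden_def)
  have "None \<in> Some ` S"
  proof (rule closed_set_contains)
    show "Some v \<in> Some ` S" using v by simp
    fix u w assume "u \<in> Some ` S" "E u w"
    then obtain a where a: "u = Some a" "a \<in> S" by auto
    have "deg E (Some a) - 1 < card {b\<in>S. E (Some a) (Some b)}"
      using S a by (auto simp: forbidden_def max_stable_def)
    hence "card {b. E (Some a) b} \<le> card (Some ` {b\<in>S. E (Some a) (Some b)})"
      by (simp add: deg_def card_image)
    hence "Some ` {b\<in>S. E (Some a) (Some b)} = {b. E (Some a) b}"
      by (intro card_seteq) auto
    thus "w \<in> Some ` S" using \<open>E u w\<close> a by blast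
  qed
  thus False by auto
qed

lemma forbidden_antimono: "forbidden E \<eta> S \<Longrightarrow> (\<And>v. v \<in> S \<Longrightarrow> \<xi> v \<le> \<eta> v) \<Longrightarrow> forbidden E \<xi> S"
  unfolding forbidden_def using le_less_trans by blast

text \<open>A toppling vertex outside \<open>S\<close> only adds chips on \<open>S\<close>. One
  inside \<open>S\<close> is removed from it: each of its neighbours then counts one neighbour less,
  but also had one chip less before the toppling.\<close>

lemma forbidden_topple:
  assumes "forbidden E (topple E v \<eta>) S" "deg E (Some v) \<le> \<eta> v"
  obtains T where "forbidden E \<eta> T"
proof (cases "v \<in> S")
  case False
  hence "forbidden E \<eta> S"
    by (intro forbidden_antimono[OF assms(1)]) (auto simp: topple_def)
  thus thesis by (rule that)
next
  case True
  have lt: "topple E v \<eta> u < card {w\<in>S. E (Some u) (Some w)}" if "u \<in> S" for u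
    using assms(1) that by (auto simp: forbidden_def)
  \<comment> \<open>There are no loops, so for \<open>S = {v}\<close> the bound would read
    \<open>topple E v \<eta> v < 0\<close>.\<close>
  have "S \<noteq> {v}" using lt[OF True] by (auto cong: conj_cong)
  moreover have "\<eta> u < card {w \<in> S - {v}. E (Some u) (Some w)}" if u: "u \<in> S - {v}" for u
  proof (cases "E (Some u) (Some v)")
    case True
    have "{w\<in>S. E (Some u) (Some w)} = insert v {w \<in> S - {v}. E (Some u) (Some w)}"
      using True \<open>v \<in> S\<close> by auto
    hence "card {w\<in>S. E (Some u) (Some w)} = Suc (card {w \<in> S - {v}. E (Some u) (Some w)})"
      by simp
    thus ?thesis using lt[of u] u True by (auto simp: topple_def edge_commute)
  next
    case False
    hence "{w\<in>S. E (Some u) (Some w)} = {w \<in> S - {v}. E (Some u) (Some w)}" by auto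
    thus ?thesis using lt[of u] u False by (auto simp: topple_def edge_commute)
  qed
  ultimately have "forbidden E \<eta> (S - {v})" using True by (auto simp: forbidden_def)
  thus thesis by (rule that)
qed

text \<open>A recurrent state is reached by legal topplings from a configuration above
  \<open>max_stable\<close>, and neither adding chips nor toppling creates a forbidden set.\<close>

lemma not_forbidden_recurrent:
  assumes "\<eta> \<in> recurrent E"
  shows "\<not> forbidden E \<eta> S"
proof -
  obtain \<sigma> where "\<eta> = stabilize E (\<lambda>u. max_stable E u + \<sigma> u)"
    using assms by (auto simp: recurrent_def oplus_def)
  hence "(legal_topple E)\<^sup>*\<^sup>* (\<lambda>u. max_stable E u + \<sigma> u) \<eta>"
    using legal_topple_stabilize by simp
  hence "\<forall>S. \<not> forbidden E \<eta> S"
  proof (induction rule: rtranclp_induct)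
    case base
    show ?case
      using forbidden_antimono not_forbidden_max_stable by (metis le_add1)
  next
    case (step \<xi> \<zeta>)
    thus ?case by (auto simp: legal_topple_def elim: forbidden_topple)
  qed
  thus ?thesis by blast
qed

lemma recurrent_firing_nonpos:
  assumes "\<eta> \<in> recurrent E" "\<xi> \<in> recurrent E" "\<And>v. w $ v \<in> \<int>"
    and eq: "config_vec \<eta> - config_vec \<xi> = reduced_laplacian E *v w"
  shows "w $ v \<le> 0"
proof (rule ccontr)
  \<comment> \<open>Otherwise the set where \<open>w\<close> is maximal would be a forbidden set of \<open>\<xi>\<close>.\<close>
  assume v: "\<not> w $ v \<le> 0"
  define M where "M = Max (range (($) w))"
  have M: "w $ u \<le> M" for u by (simp add: M_def)
  have pos: "M > 0" using v M[of v] by simp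
  define S where "S = {u. w $ u = M}"
  have "M \<in> range (($) w)" unfolding M_def by (intro Max_in) auto
  hence ne: "S \<noteq> {}" by (auto simp: S_def)
  have MZ: "M \<in> \<int>" using \<open>M \<in> range (($) w)\<close> assms(3) by auto
  have "\<xi> a < card {b\<in>S. E (Some a) (Some b)}" if a: "a \<in> S" for a
  proof -
    let ?W = "case_option 0 (($) w)"
    \<comment> \<open>\<open>w\<close> is integral, so outside \<open>S\<close> it falls short of
      \<open>M\<close> by at least 1; the sink counts with value 0, which is below
      \<open>M\<close>.\<close>
    have gap: "1 \<le> M - ?W u" if u: "u \<notin> Some ` S" for u
    proof -
      have "?W u \<in> \<int>" using assms(3) by (cases u) auto
      moreover have "?W u < M"
        using u M pos by (cases u) (auto simp: S_def less_le)
      ultimately show ?thesis using MZ by (auto elim!: Ints_cases simp flip: of_int_diff)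
    qed
    let ?N = "{u. E (Some a) u}"
    \<comment> \<open>By \<open>gap\<close> the neighbours outside \<open>S\<close> number at most
      \<open>\<eta> a - \<xi> a\<close>. Since \<open>\<eta> a\<close> is below the degree,
      \<open>\<xi> a\<close> is below the number of neighbours inside \<open>S\<close>.\<close>
    have "real (card (?N - Some ` S)) = (\<Sum>u\<in>?N - Some ` S. 1)" by simp
    also have "\<dots> \<le> (\<Sum>u\<in>?N - Some ` S. M - ?W u)" using gap by (intro sum_mono) auto
    also have "\<dots> \<le> (\<Sum>u\<in>?N. M - ?W u)"
      by (intro sum_mono2) (auto simp: S_def)
    also have "\<dots> = (reduced_laplacian E *v w) $ a"
      using a by (simp add: reduced_laplacian_mult laplacian_def S_def)
    also have "\<dots> = real (\<eta> a) - real (\<xi> a)"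
      by (simp add: eq[symmetric] config_vec_def)
    finally have "card (?N - Some ` S) + \<xi> a \<le> \<eta> a" by simp
    moreover have "\<eta> a < card ?N"
      using stable_recurrent[OF assms(1)] by (auto simp: stable_def deg_def)
    moreover have "card ?N = card (?N - Some ` S) + card (?N \<inter> Some ` S)"
      by (subst card_Un_disjoint[symmetric]) (auto intro: arg_cong[of _ _ card])
    moreover have "?N \<inter> Some ` S = Some ` {b\<in>S. E (Some a) (Some b)}" by auto
    ultimately show ?thesis by (simp add: card_image)
  qed
  hence "forbidden E \<xi> S" using ne by (auto simp: forbidden_def)
  thus False using not_forbidden_recurrent assms(2) by blast
qed

text \<open>The one-sided bound is applied to \<open>w\<close> and, with the states exchanged, to
  \<open>- w\<close>.\<close>

lemma recurrent_eqI:
  assumes "\<eta> \<in> recurrent E" "\<xi> \<in> recurrent E" "\<And>v. w $ v \<in> \<int>"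
    and eq: "config_vec \<eta> - config_vec \<xi> = reduced_laplacian E *v w"
  shows "\<eta> = \<xi>"
proof -
  have "config_vec \<xi> - config_vec \<eta> = reduced_laplacian E *v (- w)"
    using arg_cong[OF eq, of uminus] by (simp add: linear_neg[OF matrix_vector_mul_linear])
  hence "(- w) $ v \<le> 0" for v
    using assms by (intro recurrent_firing_nonpos) auto
  moreover have "w $ v \<le> 0" for v using assms by (rule recurrent_firing_nonpos)
  ultimately have "w = 0" by (auto simp: vec_eq_iff intro: order_antisym)
  hence "config_vec \<eta> = config_vec \<xi>" using eq by simp
  thus ?thesis by (auto simp: config_vec_def vec_eq_iff fun_eq_iff)
qed

end

section \<open>Fourier analysis on the sandpile group\<close>

definition turn :: "real \<Rightarrow> complex" where
  "turn t = cis (2 * pi * t)"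

lemma turn_add: "turn (a + b) = turn a * turn b"
  by (simp add: turn_def cis_mult algebra_simps)

lemma turn_diff: "turn (a - b) = turn a * cnj (turn b)"
  by (simp add: turn_def cis_mult cis_cnj algebra_simps)

lemma norm_turn [simp]: "norm (turn t) = 1"
  by (simp add: turn_def)

lemma turn_0 [simp]: "turn 0 = 1"
  by (simp add: turn_def)

lemma turn_eq_1_iff: "turn t = 1 \<longleftrightarrow> t \<in> \<int>"
proof
  assume "turn t = 1"
  hence "cos (2 * pi * t) = 1" by (simp add: turn_def complex_eq_iff)
  then obtain k :: int where "2 * pi * t = k * 2 * pi" by (auto simp: cos_one_2pi_int)
  hence "t = k" by simp
  thus "t \<in> \<int>" by simp
qed (simp add: turn_def)

lemma turn_eqI:
  assumes "a - b \<in> \<int>"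
  shows "turn a = turn b"
  using turn_add[of "a - b" b] turn_eq_1_iff assms by simp

text \<open>By concavity the sine lies above its chord on \<open>[0, pi / 2]\<close>, so
  \<open>2 * \<bar>x\<bar> \<le> sin (pi * \<bar>x\<bar>)\<close>; the double angle formula
  finishes. Equality at \<open>\<bar>x\<bar> = 1 / 2\<close> shows that 8 is the best
  constant.\<close>

lemma cos_2pi_le:
  assumes "\<bar>x\<bar> \<le> 1 / 2"
  shows "cos (2 * pi * x) \<le> 1 - 8 * x\<^sup>2"
proof -
  have conc: "concave_on {0..pi} sin"
  proof (rule f''_le0_imp_concave)
    show "(sin has_real_derivative cos x) (at x)" "(cos has_real_derivative - sin x) (at x)" for x
      by (auto intro!: derivative_eq_intros)
  qed (auto simp: sin_ge_zero)
  have "2 * \<bar>x\<bar> * sin (pi / 2) \<le> sin ((1 - 2 * \<bar>x\<bar>) *\<^sub>R 0 + (2 * \<bar>x\<bar>) *\<^sub>R (pi / 2))"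
    using concave_onD[OF conc, of "2 * \<bar>x\<bar>" 0 "pi / 2"] assms by simp
  hence "2 * \<bar>x\<bar> \<le> sin (pi * \<bar>x\<bar>)" by (simp add: mult.commute)
  hence "(2 * \<bar>x\<bar>)\<^sup>2 \<le> (sin (pi * \<bar>x\<bar>))\<^sup>2" by (intro power_mono) auto
  also have "(sin (pi * \<bar>x\<bar>))\<^sup>2 = (sin (pi * x))\<^sup>2" by (cases "x \<ge> 0") auto
  finally have "4 * x\<^sup>2 \<le> (sin (pi * x))\<^sup>2" by (simp add: power_mult_distrib)
  moreover have "cos (2 * pi * x) = 1 - 2 * (sin (pi * x))\<^sup>2"
    using cos_double_sin[of "pi * x"] by (simp add: mult.assoc)
  ultimately show ?thesis by simp
qed

section \<open>Eigenfunctions of matrix powers and exponentials\<close>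

context
  fixes S :: "'s set" and K :: "'s \<Rightarrow> 's \<Rightarrow> real"
  assumes finite: "finite S"
begin

lemma sum_mat_one_eigen: "x \<in> S \<Longrightarrow> (\<Sum>y\<in>S. of_real (mat_one x y) * f y) = f x"
  for f :: "'s \<Rightarrow> complex"
  using finite by (simp add: mat_one_def if_distrib[of "\<lambda>r. of_real r * _"] cong: if_cong)

lemma mat_power_eigen:
  fixes f :: "'s \<Rightarrow> complex"
  assumes "\<And>z. z \<in> S \<Longrightarrow> (\<Sum>y\<in>S. of_real (K z y) * f y) = \<mu> * f z" "x \<in> S"
  shows "(\<Sum>y\<in>S. of_real (mat_power S K k x y) * f y) = \<mu> ^ k * f x"
proof (induction k)
  case 0
  show ?case using assms(2) by (simp add: sum_mat_one_eigen)
next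
  case (Suc k)
  have "(\<Sum>y\<in>S. of_real (mat_power S K (Suc k) x y) * f y)
      = (\<Sum>y\<in>S. \<Sum>z\<in>S. of_real (mat_power S K k x z) * (of_real (K z y) * f y))"
    by (simp add: sum_distrib_right mult.assoc)
  also have "\<dots> = (\<Sum>z\<in>S. of_real (mat_power S K k x z) * (\<mu> * f z))"
    by (subst sum.swap) (simp add: sum_distrib_left[symmetric] assms)
  also have "\<dots> = \<mu> * (\<Sum>z\<in>S. of_real (mat_power S K k x z) * f z)"
    by (simp add: sum_distrib_left mult.left_commute)
  finally show ?case by (simp add: Suc)
qed

text \<open>Crude growth bound: one multiplication costs at most the sum of all absolute entries. It
  makes the exponential series converge.\<close>

lemma abs_mat_power_le:
  assumes "y \<in> S"
  shows "\<bar>mat_power S K k x y\<bar> \<le> (\<Sum>z\<in>S. \<Sum>w\<in>S. \<bar>K z w\<bar>) ^ k"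
  using assms
proof (induction k arbitrary: y)
  case (Suc k)
  let ?c = "\<Sum>z\<in>S. \<Sum>w\<in>S. \<bar>K z w\<bar>"
  have "\<bar>mat_power S K (Suc k) x y\<bar> \<le> (\<Sum>z\<in>S. \<bar>mat_power S K k x z\<bar> * \<bar>K z y\<bar>)"
    by (simp add: abs_mult[symmetric] sum_abs)
  also have "\<dots> \<le> (\<Sum>z\<in>S. ?c ^ k * (\<Sum>w\<in>S. \<bar>K z w\<bar>))"
    using Suc finite by (intro sum_mono mult_mono member_le_sum[of y]) (auto intro!: zero_le_power sum_nonneg)
  also have "\<dots> = ?c ^ Suc k" by (simp add: sum_distrib_left[symmetric])
  finally show ?case .
qed (simp add: mat_one_def)

text \<open>The eigenvalue of each power is known, and the finite sum over \<open>S\<close> passes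
  through the exponential series.\<close>

lemma mat_exp_eigen:
  fixes f :: "'s \<Rightarrow> complex"
  assumes "\<And>z. z \<in> S \<Longrightarrow> (\<Sum>y\<in>S. of_real (K z y) * f y) = \<mu> * f z" "x \<in> S"
  shows "(\<Sum>y\<in>S. of_real (mat_exp S K x y) * f y) = exp \<mu> * f x"
proof -
  have sums: "(\<lambda>k. mat_power S K k x y / fact k) sums mat_exp S K x y" if "y \<in> S" for y
    unfolding mat_exp_def
  proof (rule summable_sums, rule summable_comparison_test')
    let ?c = "\<Sum>z\<in>S. \<Sum>w\<in>S. \<bar>K z w\<bar>"
    show "summable (\<lambda>k. ?c ^ k / fact k)"
      using summable_exp[of ?c] by (simp add: divide_inverse mult.commute)
    show "norm (mat_power S K k x y / fact k) \<le> ?c ^ k / fact k" for k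
      using abs_mat_power_le[OF that, of k x] by (simp add: divide_right_mono)
  qed
  have "(\<lambda>k. \<Sum>y\<in>S. of_real (mat_power S K k x y / fact k) * f y)
      sums (\<Sum>y\<in>S. of_real (mat_exp S K x y) * f y)"
    by (intro sums_sum sums_mult2 sums_of_real sums)
  also have "(\<lambda>k. \<Sum>y\<in>S. of_real (mat_power S K k x y / fact k) * f y) = (\<lambda>k. \<mu> ^ k /\<^sub>R fact k * f x)"
  proof
    fix k
    have "(\<Sum>y\<in>S. of_real (mat_power S K k x y / fact k) * f y)
        = (\<Sum>y\<in>S. of_real (mat_power S K k x y) * f y) / fact k"
      by (simp add: sum_divide_distrib)
    thus "(\<Sum>y\<in>S. of_real (mat_power S K k x y / fact k) * f y) = \<mu> ^ k /\<^sub>R fact k * f x"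
      by (simp add: mat_power_eigen[OF assms] scaleR_conv_of_real divide_inverse)
  qed
  finally show ?thesis
    using sums_mult2[OF exp_converges[of \<mu>], of "f x"] sums_unique2 by blast
qed

end

section \<open>Reduction modulo integer vectors to coordinates in \<open>[-1/2, 1/2)\<close>\<close>

definition frac_vec :: "real^'n \<Rightarrow> real^'n" where
  "frac_vec x = (\<chi> v. x $ v - \<lfloor>x $ v + 1 / 2\<rfloor>)"

lemma frac_vec_bounds: "- 1 / 2 \<le> frac_vec x $ v" "frac_vec x $ v < 1 / 2"
  unfolding frac_vec_def vec_lambda_beta by linarith+

lemma diff_frac_vec: "(x - frac_vec x) $ v \<in> \<int>"
  by (simp add: frac_vec_def)

lemma frac_vec_eqI:
  assumes "\<And>v. (x - y) $ v \<in> \<int>"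
  shows "frac_vec x = frac_vec y"
proof (unfold frac_vec_def vec_eq_iff vec_lambda_beta, intro allI)
  fix v
  obtain k where "(x - y) $ v = of_int k" using assms Ints_cases by blast
  hence "x $ v = y $ v + of_int k" by simp
  moreover have "\<lfloor>y $ v + of_int k + 1 / 2\<rfloor> = \<lfloor>y $ v + 1 / 2\<rfloor> + k"
    by (simp add: floor_eq_iff)
  ultimately show "x $ v - \<lfloor>x $ v + 1 / 2\<rfloor> = y $ v - \<lfloor>y $ v + 1 / 2\<rfloor>" by simp
qed

lemma frac_vec_id:
  assumes "\<And>v. - 1 / 2 \<le> x $ v \<and> x $ v < 1 / 2"
  shows "frac_vec x = x"
proof -
  have "\<lfloor>x $ v + 1 / 2\<rfloor> = 0" for v
    using assms[of v] by (simp add: floor_eq_iff)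
  thus ?thesis by (simp add: frac_vec_def vec_eq_iff)
qed

lemma turn_inner_cong:
  fixes x y d :: "real^'n"
  assumes "\<And>v. (x - y) $ v \<in> \<int>" "\<And>v. d $ v \<in> \<int>"
  shows "turn (x \<bullet> d) = turn (y \<bullet> d)"
proof (rule turn_eqI)
  have "x \<bullet> d - y \<bullet> d = (\<Sum>v\<in>UNIV. (x - y) $ v * d $ v)"
    by (simp add: inner_vec_def left_diff_distrib sum_subtractf)
  thus "x \<bullet> d - y \<bullet> d \<in> \<int>" using assms by (auto intro!: Ints_sum Ints_mult)
qed

lemma integer_matrix_mult:
  assumes "\<And>i j. A $ i $ j \<in> \<int>" "\<And>j. z $ j \<in> \<int>"
  shows "(A *v z) $ i \<in> \<int>"
  unfolding matrix_vector_mult_def using assms by (auto intro!: Ints_sum Ints_mult)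

section \<open>Characters of the sandpile group and their orthogonality\<close>

context sandpile_graph
begin

abbreviation \<Delta> where "\<Delta> \<equiv> reduced_laplacian E"

text \<open>This is the dual of the lattice generated by \<open>\<Delta>\<close> (see
  \<open>dual_lattice_reduced\<close>); symmetry allows \<open>\<Delta> *v x\<close> in place of
  \<open>x v* \<Delta>\<close>.\<close>

definition dual_points :: "(real^'a) set" where
  "dual_points = {x. \<forall>v. (\<Delta> *v x) $ v \<in> \<int>}"

text \<open>Representatives of \<open>(\<Delta>\<int>\<^sup>n\<^sup>-\<^sup>1)\<^sup>* / \<int>\<^sup>n\<^sup>-\<^sup>1\<close>, which is the character group of the sandpile group.\<close>

definition character_points :: "(real^'a) set" where
  "character_points = {x \<in> dual_points. \<forall>v. - 1 / 2 \<le> x $ v \<and> x $ v < 1 / 2}"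

lemma reduced_laplacian_Ints: "\<Delta> $ u $ v \<in> \<int>"
  by (simp add: reduced_laplacian_def full_laplacian_def)

lemma dual_points_integer:
  assumes "\<And>v. z $ v \<in> \<int>"
  shows "z \<in> dual_points"
  using integer_matrix_mult[OF reduced_laplacian_Ints assms] by (simp add: dual_points_def)

lemma dual_points_add: "x \<in> dual_points \<Longrightarrow> y \<in> dual_points \<Longrightarrow> x + y \<in> dual_points"
  by (simp add: dual_points_def matrix_vector_right_distrib)

lemma dual_points_diff: "x \<in> dual_points \<Longrightarrow> y \<in> dual_points \<Longrightarrow> x - y \<in> dual_points"
  by (simp add: dual_points_def matrix_vector_mult_diff_distrib)

lemma character_points_dual: "x \<in> character_points \<Longrightarrow> x \<in> dual_points"
  by (simp add: character_points_def)

lemma frac_vec_mem: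
  assumes "x \<in> dual_points"
  shows "frac_vec x \<in> character_points"
proof -
  have "x - frac_vec x \<in> dual_points" by (rule dual_points_integer) (rule diff_frac_vec)
  from dual_points_diff[OF assms this] show ?thesis
    using frac_vec_bounds[of x] by (simp add: character_points_def)
qed

text \<open>\<open>\<Delta>\<close> maps these points injectively to integer vectors with bounded
  coordinates.\<close>

lemma finite_character_points: "finite character_points"
proof -
  obtain C where C: "norm (\<Delta> *v x) \<le> norm x * C" "C > 0" for x
    using bounded_linear.pos_bounded[OF matrix_vector_mul_bounded_linear] by blast
  define B where "B = \<lceil>CARD('a) * C\<rceil>"
  have "(\<lambda>x. \<Delta> *v x) ` character_points
      \<subseteq> (\<lambda>f. \<chi> v. of_int (f v)) ` PiE UNIV (\<lambda>_. {- B..B})"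
  proof clarify
    fix x assume x: "x \<in> character_points"
    have "norm x \<le> (\<Sum>v\<in>UNIV. \<bar>x $ v\<bar>)" by (rule norm_le_l1_cart)
    also have "\<dots> \<le> (\<Sum>v\<in>(UNIV :: 'a set). 1)"
    proof (rule sum_mono)
      fix v
      have "- 1 / 2 \<le> x $ v" "x $ v < 1 / 2" using x by (simp_all add: character_points_def)
      thus "\<bar>x $ v\<bar> \<le> 1" by arith
    qed
    finally have "norm x * C \<le> CARD('a) * C" using C(2) by (intro mult_right_mono) auto
    hence "norm (\<Delta> *v x) \<le> B" using C(1)[of x] unfolding B_def by linarith
    hence abs: "\<bar>(\<Delta> *v x) $ v\<bar> \<le> B" for v using component_le_norm_cart[of "\<Delta> *v x" v] by linarith
    have floor: "of_int \<lfloor>(\<Delta> *v x) $ v\<rfloor> = (\<Delta> *v x) $ v" for v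
      using x by (auto simp: character_points_def dual_points_def elim!: allE[of _ v] Ints_cases)
    have bound: "\<bar>of_int \<lfloor>(\<Delta> *v x) $ v\<rfloor>\<bar> \<le> real_of_int B" for v
      unfolding floor by (rule abs)
    have "\<lfloor>(\<Delta> *v x) $ v\<rfloor> \<in> {- B..B}" for v
      using bound[of v] by (simp only: of_int_abs[symmetric] of_int_le_iff abs_le_iff) simp
    moreover have "\<Delta> *v x = (\<chi> v. of_int \<lfloor>(\<Delta> *v x) $ v\<rfloor>)"
      unfolding floor by (simp only: vec_lambda_eta)
    ultimately show "\<Delta> *v x \<in> (\<lambda>f. \<chi> v. of_int (f v)) ` PiE UNIV (\<lambda>_. {- B..B})"
      by (intro image_eqI[of _ _ "\<lambda>v. \<lfloor>(\<Delta> *v x) $ v\<rfloor>"]) auto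
  qed
  hence "finite ((\<lambda>x. \<Delta> *v x) ` character_points)"
    by (rule finite_subset) (intro finite_imageI finite_PiE; simp)
  moreover have "inj_on (\<lambda>x. \<Delta> *v x) character_points"
    by (rule inj_on_inverseI[of _ "\<lambda>x. matrix_inv \<Delta> *v x"]) (rule reduced_laplacian_inverse')
  ultimately show ?thesis by (rule finite_imageD)
qed

lemma config_vec_Ints: "config_vec \<eta> $ v \<in> \<int>"
  by (simp add: config_vec_def)

text \<open>If the images of two states under the inverse of \<open>\<Delta>\<close> agree modulo
  integer vectors, the states are congruent modulo the lattice and \<open>recurrent_eqI\<close>
  applies.\<close>

lemma card_recurrent_le: "card (recurrent E) \<le> card character_points"
proof (rule card_inj_on_le[OF _ _ finite_character_points])
  let ?f = "\<lambda>\<eta>. frac_vec (matrix_inv \<Delta> *v config_vec \<eta>)"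
  show "?f ` recurrent E \<subseteq> character_points"
    by (auto intro!: frac_vec_mem simp: dual_points_def reduced_laplacian_inverse config_vec_Ints)
  show "inj_on ?f (recurrent E)"
  proof (rule inj_onI)
    fix \<eta> \<xi> assume "\<eta> \<in> recurrent E" "\<xi> \<in> recurrent E" and eq: "?f \<eta> = ?f \<xi>"
    let ?w = "matrix_inv \<Delta> *v (config_vec \<eta> - config_vec \<xi>)"
    have "?w $ v \<in> \<int>" for v
    proof -
      have "?w $ v = (matrix_inv \<Delta> *v config_vec \<eta> - ?f \<eta>) $ v
          - (matrix_inv \<Delta> *v config_vec \<xi> - ?f \<xi>) $ v"
        by (simp add: matrix_vector_mult_diff_distrib eq)
      thus ?thesis using diff_frac_vec by (metis Ints_diff)
    qed
    thus "\<eta> = \<xi>"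
      using \<open>\<eta> \<in> recurrent E\<close> \<open>\<xi> \<in> recurrent E\<close>
      by (rule_tac recurrent_eqI[of _ _ ?w]) (simp_all add: reduced_laplacian_inverse)
  qed
qed

text \<open>The columns of the inverse of \<open>\<Delta>\<close> are dual points, and pairing with
  them reads off the coordinates of the firing vector \<open>?w\<close>.\<close>

lemma characters_separate:
  assumes "\<eta> \<in> recurrent E" "\<xi> \<in> recurrent E"
    and "\<And>y. y \<in> dual_points \<Longrightarrow> y \<bullet> (config_vec \<eta> - config_vec \<xi>) \<in> \<int>"
  shows "\<eta> = \<xi>"
proof (rule recurrent_eqI[OF assms(1,2)])
  let ?w = "matrix_inv \<Delta> *v (config_vec \<eta> - config_vec \<xi>)"
  show eq: "config_vec \<eta> - config_vec \<xi> = \<Delta> *v ?w"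
    by (simp add: reduced_laplacian_inverse)
  fix v
  let ?y = "matrix_inv \<Delta> *v axis v 1"
  have "?w $ v = axis v 1 \<bullet> ?w"
    by (simp only: cart_eq_inner_axis inner_commute)
  also have "\<dots> = (\<Delta> *v ?y) \<bullet> ?w"
    by (simp only: reduced_laplacian_inverse)
  also have "\<dots> = ?y \<bullet> (config_vec \<eta> - config_vec \<xi>)"
    by (subst reduced_laplacian_self_adjoint) (simp only: reduced_laplacian_inverse)
  also have "\<dots> \<in> \<int>"
    by (rule assms(3)) (simp add: dual_points_def reduced_laplacian_inverse axis_def)
  finally show "?w $ v \<in> \<int>" .
qed

text \<open>Translation by a dual point \<open>y\<close> that distinguishes the two states permutes
  the characters, but multiplies the sum by \<open>turn (y \<bullet> ?d)\<close>, which is not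
  1.\<close>

lemma sum_characters:
  assumes "\<eta> \<in> recurrent E" "\<xi> \<in> recurrent E"
  shows "(\<Sum>x\<in>character_points. turn (x \<bullet> (config_vec \<eta> - config_vec \<xi>)))
    = (if \<eta> = \<xi> then of_nat (card character_points) else 0)"
proof (cases "\<eta> = \<xi>")
  case False
  let ?d = "config_vec \<eta> - config_vec \<xi>"
  have d: "?d $ v \<in> \<int>" for v by (simp add: config_vec_Ints)
  obtain y where y: "y \<in> dual_points" "y \<bullet> ?d \<notin> \<int>"
    using characters_separate[OF assms] False by blast
  \<comment> \<open>Translation acts on representatives by reducing again; this makes translating
    back its inverse.\<close>
  have shift_back: "frac_vec (frac_vec (x + z) - z) = x" if "x \<in> character_points" for x z
  proof -
    have "frac_vec (frac_vec (x + z) - z) = frac_vec x"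
      using diff_frac_vec[of "x + z"] by (intro frac_vec_eqI) (simp add: frac_vec_def)
    thus ?thesis using that frac_vec_id[of x] by (simp add: character_points_def)
  qed
  have mem: "frac_vec (x + y) \<in> character_points" "frac_vec (x - y) \<in> character_points"
    if "x \<in> character_points" for x
    by (intro frac_vec_mem dual_points_add dual_points_diff character_points_dual that y(1))+
  have "(\<Sum>x\<in>character_points. turn (x \<bullet> ?d)) = (\<Sum>x\<in>character_points. turn ((x + y) \<bullet> ?d))"
  proof (rule sum.reindex_bij_witness[of _ "\<lambda>x. frac_vec (x + y)" "\<lambda>x. frac_vec (x - y)"])
    fix x assume x: "x \<in> character_points"
    show "frac_vec (frac_vec (x - y) + y) = x" using shift_back[OF x, of "- y"] by simp
    show "frac_vec (frac_vec (x + y) - y) = x" by (rule shift_back[OF x])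
    have "turn (frac_vec (x - y) \<bullet> ?d + y \<bullet> ?d) = turn ((x - y) \<bullet> ?d) * turn (y \<bullet> ?d)"
      unfolding turn_add using turn_inner_cong[OF diff_frac_vec d, of "x - y"] by simp
    thus "turn ((frac_vec (x - y) + y) \<bullet> ?d) = turn (x \<bullet> ?d)"
      by (simp add: turn_add[symmetric] inner_add_left inner_diff_left)
  qed (use mem in auto)
  also have "\<dots> = (\<Sum>x\<in>character_points. turn (x \<bullet> ?d)) * turn (y \<bullet> ?d)"
    by (simp add: inner_add_left turn_add sum_distrib_right)
  finally have "(\<Sum>x\<in>character_points. turn (x \<bullet> ?d)) = 0"
    using y(2) by (simp add: turn_eq_1_iff)
  thus ?thesis using False by simp
qed simp

section \<open>Fourier coefficients, eigenvalues of the chain and the distance to uniform\<close>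

definition fourier :: "('a config \<Rightarrow> real) \<Rightarrow> real^'a \<Rightarrow> complex" where
  "fourier f x = (\<Sum>\<eta>\<in>recurrent E. of_real (f \<eta>) * turn (x \<bullet> config_vec \<eta>))"

text \<open>Expand the squared modulus and sum over the characters first:
  \<open>sum_characters\<close> leaves only the diagonal.\<close>

lemma parseval:
  fixes f :: "'a config \<Rightarrow> real"
  shows "(\<Sum>x\<in>character_points. (norm (fourier f x))\<^sup>2)
    = card character_points * (\<Sum>\<eta>\<in>recurrent E. (f \<eta>)\<^sup>2)"
proof -
  let ?G = "recurrent E"
  have "complex_of_real (\<Sum>x\<in>character_points. (norm (fourier f x))\<^sup>2)
      = (\<Sum>x\<in>character_points. fourier f x * cnj (fourier f x))"
    by (simp only: of_real_sum complex_norm_square)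
  also have "\<dots> = (\<Sum>x\<in>character_points. \<Sum>\<eta>\<in>?G. \<Sum>\<xi>\<in>?G.
      complex_of_real (f \<eta> * f \<xi>) * turn (x \<bullet> (config_vec \<eta> - config_vec \<xi>)))"
    by (simp add: fourier_def sum_product inner_diff_right turn_diff mult_ac)
  also have "\<dots> = (\<Sum>\<eta>\<in>?G. \<Sum>x\<in>character_points. \<Sum>\<xi>\<in>?G.
      complex_of_real (f \<eta> * f \<xi>) * turn (x \<bullet> (config_vec \<eta> - config_vec \<xi>)))"
    by (rule sum.swap)
  also have "\<dots> = (\<Sum>\<eta>\<in>?G. \<Sum>\<xi>\<in>?G. complex_of_real (f \<eta> * f \<xi>)
      * (\<Sum>x\<in>character_points. turn (x \<bullet> (config_vec \<eta> - config_vec \<xi>))))"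
    unfolding sum_distrib_left by (intro sum.cong refl sum.swap)
  also have "\<dots> = (\<Sum>\<eta>\<in>?G. \<Sum>\<xi>\<in>?G. if \<eta> = \<xi> then complex_of_real (f \<eta> * f \<eta>) * card character_points else 0)"
    by (intro sum.cong refl) (simp add: sum_characters)
  also have "\<dots> = of_real (card character_points * (\<Sum>\<eta>\<in>?G. (f \<eta>)\<^sup>2))"
    by (simp add: finite_recurrent sum_distrib_left power2_eq_square mult_ac)
  finally show ?thesis by (simp only: of_real_eq_iff)
qed

definition add_chip :: "'a option \<Rightarrow> 'a config \<Rightarrow> 'a config" where
  "add_chip v \<eta> = stabilize E (\<lambda>u. \<eta> u + chip v u)"

text \<open>The chip adds one coordinate of \<open>x\<close>, with value 0 at the sink, and the
  topplings that follow change the pairing by integers.\<close>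

lemma inner_add_chip:
  assumes "x \<in> dual_points"
  shows "x \<bullet> config_vec \<eta> + case_option 0 (($) x) v - x \<bullet> config_vec (add_chip v \<eta>) \<in> \<int>"
proof -
  have "x \<bullet> config_vec (\<lambda>u. \<eta> u + chip v u) = x \<bullet> config_vec \<eta> + x \<bullet> config_vec (chip v)"
    by (simp add: inner_vec_def config_vec_def sum.distrib distrib_left)
  also have "x \<bullet> config_vec (chip v) = case_option 0 (($) x) v"
    by (cases v) (auto simp: inner_vec_def config_vec_def chip_def if_distrib cong: if_cong)
  finally have eq: "x \<bullet> config_vec (\<lambda>u. \<eta> u + chip v u) = x \<bullet> config_vec \<eta> + case_option 0 (($) x) v" .
  show ?thesis
    unfolding eq[symmetric] add_chip_def
    by (rule inner_config_vec_legal_topple[OF legal_topple_stabilize])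
      (use assms in \<open>simp add: dual_points_def\<close>)
qed

lemma turn_add_chip:
  assumes "x \<in> dual_points"
  shows "turn (x \<bullet> config_vec (add_chip v \<eta>)) = turn (case_option 0 (($) x) v) * turn (x \<bullet> config_vec \<eta>)"
  using turn_eqI[OF inner_add_chip[OF assms]] by (simp add: turn_add mult.commute)

lemma add_chip_recurrent: "\<eta> \<in> recurrent E \<Longrightarrow> add_chip v \<eta> \<in> recurrent E"
  unfolding add_chip_def by (rule recurrent_add_chip)

text \<open>Modulo 1 a chip shifts the pairing with a fixed dual point equally for all states, so
  separation by characters gives injectivity; finiteness gives the rest.\<close>

lemma bij_add_chip: "bij_betw (add_chip v) (recurrent E) (recurrent E)"
proof (rule endo_inj_surj[OF finite_recurrent, THEN bij_betw_imageI[rotated]])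
  show sub: "add_chip v ` recurrent E \<subseteq> recurrent E" using add_chip_recurrent by auto
  show inj: "inj_on (add_chip v) (recurrent E)"
  proof (rule inj_onI)
    fix \<eta> \<xi> assume G: "\<eta> \<in> recurrent E" "\<xi> \<in> recurrent E" and eq: "add_chip v \<eta> = add_chip v \<xi>"
    show "\<eta> = \<xi>"
    proof (rule characters_separate[OF G])
      fix y assume "y \<in> dual_points"
      from Ints_diff[OF inner_add_chip[OF this, of \<eta> v] inner_add_chip[OF this, of \<xi> v]]
      show "y \<bullet> (config_vec \<eta> - config_vec \<xi>) \<in> \<int>"
        by (simp add: eq inner_diff_right)
    qed
  qed
  show "inj_on (add_chip v) (recurrent E)" by (rule inj)
qed

text \<open>Adding a chip where \<open>x\<close> has a nonzero coordinate permutes the states and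
  multiplies the sum by \<open>turn (x $ v)\<close>. This is not 1, as 0 is the only integer in
  \<open>[-1/2, 1/2)\<close>.\<close>

lemma sum_character_recurrent:
  assumes "x \<in> character_points" "x \<noteq> 0"
  shows "(\<Sum>\<eta>\<in>recurrent E. turn (x \<bullet> config_vec \<eta>)) = 0"
proof -
  let ?s = "\<Sum>\<eta>\<in>recurrent E. turn (x \<bullet> config_vec \<eta>)"
  obtain v where v: "x $ v \<noteq> 0" using assms(2) by (auto simp: vec_eq_iff)
  have "x $ v \<notin> \<int>"
  proof
    assume "x $ v \<in> \<int>"
    then obtain k where k: "x $ v = of_int k" by (rule Ints_cases)
    have "- 1 / 2 \<le> x $ v" "x $ v < 1 / 2" using assms(1) by (auto simp: character_points_def)
    thus False using v k by (auto simp: k)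
  qed
  have "?s = (\<Sum>\<eta>\<in>recurrent E. turn (x \<bullet> config_vec (add_chip (Some v) \<eta>)))"
    by (rule sum.reindex_bij_betw[OF bij_add_chip, symmetric])
  also have "\<dots> = turn (x $ v) * ?s"
    using assms(1) by (simp add: turn_add_chip character_points_def sum_distrib_left)
  finally show ?thesis using \<open>x $ v \<notin> \<int>\<close> by (simp add: turn_eq_1_iff)
qed

definition eigenvalue :: "real^'a \<Rightarrow> complex" where
  "eigenvalue x = (\<Sum>v\<in>UNIV. turn (case_option 0 (($) x) v)) / CARD('a option)"

text \<open>A step averages over the vertices \<open>v\<close>, and each added chip multiplies the
  character by a factor independent of the state.\<close>

lemma sandpile_P_eigen:
  assumes "x \<in> dual_points" "\<eta> \<in> recurrent E"
  shows "(\<Sum>\<xi>\<in>recurrent E. of_real (sandpile_P E \<eta> \<xi>) * turn (x \<bullet> config_vec \<xi>))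
    = eigenvalue x * turn (x \<bullet> config_vec \<eta>)"
proof -
  let ?n = "of_nat CARD('a option) :: complex"
  have P: "of_real (sandpile_P E \<eta> \<xi>) = (\<Sum>v\<in>UNIV. if \<xi> = add_chip v \<eta> then 1 else 0) / ?n" for \<xi>
  proof -
    have "sandpile_P E \<eta> \<xi> = card {v. \<xi> = add_chip v \<eta>} / CARD('a option)"
      by (simp add: sandpile_P_def pmf_map measure_pmf_of_set add_chip_def vimage_def eq_commute)
    thus ?thesis by (simp add: sum.If_cases)
  qed
  have "(\<Sum>\<xi>\<in>recurrent E. of_real (sandpile_P E \<eta> \<xi>) * turn (x \<bullet> config_vec \<xi>))
      = (\<Sum>\<xi>\<in>recurrent E. \<Sum>v\<in>UNIV. if \<xi> = add_chip v \<eta> then turn (x \<bullet> config_vec \<xi>) else 0) / ?n"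
    unfolding P by (simp add: sum_distrib_right sum_divide_distrib if_distrib[of "\<lambda>c. c * _"] cong: if_cong)
  also have "\<dots> = (\<Sum>v\<in>UNIV. turn (x \<bullet> config_vec (add_chip v \<eta>))) / ?n"
    by (subst sum.swap) (simp add: finite_recurrent add_chip_recurrent assms(2))
  also have "\<dots> = eigenvalue x * turn (x \<bullet> config_vec \<eta>)"
    by (simp add: turn_add_chip[OF assms(1)] eigenvalue_def sum_distrib_right)
  finally show ?thesis .
qed

lemma eigenvalue_0: "eigenvalue 0 = 1"
proof -
  have "case_option 0 (($) (0 :: real^'a)) v = 0" for v by (cases v) auto
  moreover have "(of_nat (Suc CARD('a)) :: complex) \<noteq> 0" by (rule of_nat_neq_0)
  ultimately show ?thesis by (simp add: eigenvalue_def)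
qed

lemma fourier_discrete_dist:
  assumes "x \<in> dual_points" "\<sigma> \<in> recurrent E"
  shows "fourier (discrete_dist E t \<sigma>) x = eigenvalue x ^ t * turn (x \<bullet> config_vec \<sigma>)"
  unfolding fourier_def discrete_dist_def
  by (rule mat_power_eigen[OF finite_recurrent sandpile_P_eigen[OF assms(1)] assms(2)])

lemma fourier_continuous_dist:
  assumes "x \<in> dual_points" "\<sigma> \<in> recurrent E"
  shows "fourier (continuous_dist E t \<sigma>) x
    = exp (of_real (- t) * (1 - eigenvalue x)) * turn (x \<bullet> config_vec \<sigma>)"
  unfolding fourier_def continuous_dist_def
proof (rule mat_exp_eigen[OF finite_recurrent _ assms(2)])
  fix \<eta> assume \<eta>: "\<eta> \<in> recurrent E"
  let ?f = "\<lambda>\<xi>. turn (x \<bullet> config_vec \<xi>)"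
  have "(\<Sum>\<xi>\<in>recurrent E. of_real (- t * (mat_one \<eta> \<xi> - sandpile_P E \<eta> \<xi>)) * ?f \<xi>)
      = of_real (- t) * ((\<Sum>\<xi>\<in>recurrent E. of_real (mat_one \<eta> \<xi>) * ?f \<xi>)
          - (\<Sum>\<xi>\<in>recurrent E. of_real (sandpile_P E \<eta> \<xi>) * ?f \<xi>))"
    by (simp add: sum_subtractf[symmetric] sum_distrib_left algebra_simps)
  also have "\<dots> = of_real (- t) * (1 - eigenvalue x) * ?f \<eta>"
    unfolding sum_mat_one_eigen[OF finite_recurrent \<eta>] sandpile_P_eigen[OF assms(1) \<eta>]
    by (simp add: algebra_simps)
  finally show "(\<Sum>\<xi>\<in>recurrent E. of_real (- t * (mat_one \<eta> \<xi> - sandpile_P E \<eta> \<xi>)) * ?f \<xi>)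
      = of_real (- t) * (1 - eigenvalue x) * ?f \<eta>" .
qed

text \<open>Subtracting the uniform distribution cancels the coefficient at 0, the total mass, and
  leaves the others unchanged. Then Parseval applies, after \<open>card_recurrent_le\<close>
  replaces the normalizing factor.\<close>

lemma l2_dist_uniform_le:
  assumes "\<sigma> \<in> recurrent E" "fourier \<mu> 0 = 1"
  shows "(l2_dist (recurrent E) \<mu> (uniform_dist E))\<^sup>2
    \<le> (\<Sum>x\<in>character_points - {0}. (norm (fourier \<mu> x))\<^sup>2)"
proof -
  let ?G = "recurrent E"
  let ?f = "\<lambda>\<eta>. \<mu> \<eta> - uniform_dist E \<eta>"
  have ne: "?G \<noteq> {}" using assms(1) by auto
  have u: "uniform_dist E \<eta> = 1 / card ?G" if "\<eta> \<in> ?G" for \<eta>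
    using that ne finite_recurrent by (simp add: uniform_dist_def)
  have diff: "fourier ?f x = fourier \<mu> x - (\<Sum>\<eta>\<in>?G. turn (x \<bullet> config_vec \<eta>)) / card ?G" for x
    by (simp add: fourier_def u left_diff_distrib sum_subtractf sum_divide_distrib)
  have f0: "fourier ?f 0 = 0"
    using ne finite_recurrent by (simp add: diff assms(2))
  have fx: "fourier ?f x = fourier \<mu> x" if "x \<in> character_points - {0}" for x
    using that by (simp add: diff sum_character_recurrent)
  have "(l2_dist ?G \<mu> (uniform_dist E))\<^sup>2 = card ?G * (\<Sum>\<eta>\<in>?G. (?f \<eta>)\<^sup>2)"
    by (simp add: l2_dist_def sum_nonneg)
  also have "\<dots> \<le> card character_points * (\<Sum>\<eta>\<in>?G. (?f \<eta>)\<^sup>2)"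
    using card_recurrent_le by (intro mult_right_mono sum_nonneg) auto
  also have "\<dots> = (\<Sum>x\<in>character_points. (norm (fourier ?f x))\<^sup>2)"
    by (rule parseval[symmetric])
  also have "\<dots> = (\<Sum>x\<in>character_points - {0}. (norm (fourier ?f x))\<^sup>2)"
    using f0 by (intro sum.mono_neutral_right finite_character_points) auto
  also have "\<dots> = (\<Sum>x\<in>character_points - {0}. (norm (fourier \<mu> x))\<^sup>2)"
    by (simp add: fx)
  finally show ?thesis .
qed

end

section \<open>Mixing times\<close>

text \<open>Both mixing bounds end this way: assigning distinct nonzero dual vectors to the
  characters produces a partial sum of the Gaussian sum.\<close>

lemma sum_le_gaussian_sum:
  assumes "r > 0" "finite X" "inj_on f X" "f ` X \<subseteq> dual_lattice (image_lattice A) - {0}"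
  shows "(\<Sum>x\<in>X. exp (- pi * r\<^sup>2 * (norm (f x))\<^sup>2)) \<le> gaussian_sum (image_lattice A) r"
proof -
  have "(\<Sum>x\<in>X. exp (- pi * r\<^sup>2 * (norm (f x))\<^sup>2)) = (\<Sum>y\<in>f ` X. exp (- pi * r\<^sup>2 * (norm y)\<^sup>2))"
    by (simp add: sum.reindex[OF assms(3)])
  also have "\<dots> \<le> gaussian_sum (image_lattice A) r"
    unfolding gaussian_sum_def
    by (rule finite_sum_le_infsum[OF summable_on_subset_banach[OF
          gaussian_summable_on_dual_image_lattice[OF assms(1)]]]) (use assms in auto)
  finally show ?thesis .
qed

lemma smoothing_parameter_image_lattice:
  assumes "x \<in> dual_lattice (image_lattice A)" "x \<noteq> 0" "\<epsilon> > 0"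
  shows "smoothing_parameter \<epsilon> (image_lattice A) > 0"
    "gaussian_sum (image_lattice A) (smoothing_parameter \<epsilon> (image_lattice A)) = \<epsilon>"
  using assms by (auto intro!: smoothing_parameter summable_on_subset_banach[OF
        gaussian_summable_on_dual_image_lattice])

context sandpile_graph
begin

section \<open>The bound in continuous time\<close>

lemma card_vertices_pos: "real CARD('a option) > 0"
  by simp

text \<open>As \<open>\<Delta>\<close> is invertible, its lattice spans the whole space and the span
  condition is automatic.\<close>

lemma dual_lattice_reduced: "dual_lattice (image_lattice \<Delta>) = dual_points"
proof -
  have "x \<in> range ((*v) \<Delta>)" for x
    by (rule range_eqI[of _ _ "matrix_inv \<Delta> *v x"]) (simp add: reduced_laplacian_inverse)
  thus ?thesis
    by (auto simp: dual_lattice_image_lattice vector_reduced_laplacian dual_points_def)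
qed

text \<open>\<open>cos_2pi_le\<close> is applied to each coordinate; the sink has coordinate 0 and
  adds nothing to the norm.\<close>

lemma Re_eigenvalue_le:
  assumes "x \<in> character_points"
  shows "Re (eigenvalue x) \<le> 1 - 8 * (norm x)\<^sup>2 / CARD('a option)"
proof -
  have "(\<Sum>v\<in>UNIV. cos (2 * pi * case_option 0 (($) x) v))
      \<le> (\<Sum>v\<in>UNIV. 1 - 8 * (case_option 0 (($) x) v)\<^sup>2)"
  proof (intro sum_mono cos_2pi_le)
    fix v :: "'a option"
    have "- 1 / 2 \<le> x $ u \<and> x $ u < 1 / 2" for u
      using assms by (simp add: character_points_def)
    hence "\<bar>x $ u\<bar> \<le> 1 / 2" for u by (smt (verit) minus_divide_left)
    thus "\<bar>case_option 0 (($) x) v\<bar> \<le> 1 / 2" by (cases v) auto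
  qed
  also have "\<dots> = CARD('a option) - 8 * (norm x)\<^sup>2"
    by (simp add: sum_option norm_vec_def L2_set_def sum_nonneg sum_subtractf sum_distrib_left[symmetric])
  finally have "(\<Sum>v\<in>UNIV. cos (2 * pi * case_option 0 (($) x) v)) / CARD('a option) \<le> (CARD('a option) - 8 * (norm x)\<^sup>2) / CARD('a option)"
    by (intro divide_right_mono) auto
  also have "\<dots> = 1 - 8 * (norm x)\<^sup>2 / CARD('a option)"
    using card_vertices_pos by (simp add: diff_divide_distrib)
  finally show ?thesis by (simp add: eigenvalue_def turn_def)
qed

theorem continuous_mixing:
  assumes "\<epsilon> > 0" "\<sigma> \<in> recurrent E"
    and t: "pi / 16 * CARD('a option) * (smoothing_parameter \<epsilon> (image_lattice \<Delta>))\<^sup>2 \<le> t"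
  shows "(l2_dist (recurrent E) (continuous_dist E t \<sigma>) (uniform_dist E))\<^sup>2 \<le> \<epsilon>"
proof -
  define r where "r = smoothing_parameter \<epsilon> (image_lattice \<Delta>)"
  fix a :: 'a
  \<comment> \<open>A nonzero dual vector, which makes the smoothing parameter well defined.\<close>
  have "axis a 1 \<in> dual_lattice (image_lattice \<Delta>)"
    unfolding dual_lattice_reduced by (intro dual_points_integer) (simp add: axis_def)
  hence r: "r > 0" "gaussian_sum (image_lattice \<Delta>) r = \<epsilon>"
    unfolding r_def using assms(1) by (auto intro!: smoothing_parameter_image_lattice simp: axis_eq_0_iff)
  \<comment> \<open>\<open>16 = 2 * 8\<close>: the cosine bound gives 8, and squaring the modulus
    doubles the exponent.\<close>
  have t16: "pi * r\<^sup>2 \<le> 16 * t / CARD('a option)" and "t \<ge> 0"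
  proof -
    show "pi * r\<^sup>2 \<le> 16 * t / CARD('a option)"
      using t[folded r_def] card_vertices_pos by (simp add: field_simps del: card_option)
    show "t \<ge> 0" by (rule order_trans[OF _ t]) simp
  qed
  have "(l2_dist (recurrent E) (continuous_dist E t \<sigma>) (uniform_dist E))\<^sup>2
      \<le> (\<Sum>x\<in>character_points - {0}. (norm (fourier (continuous_dist E t \<sigma>) x))\<^sup>2)"
    by (rule l2_dist_uniform_le[OF assms(2)])
      (simp add: fourier_continuous_dist[OF _ assms(2)] dual_points_integer eigenvalue_0)
  also have "\<dots> \<le> (\<Sum>x\<in>character_points - {0}. exp (- pi * r\<^sup>2 * (norm x)\<^sup>2))"
  proof (rule sum_mono)
    fix x assume "x \<in> character_points - {0}"
    hence x: "x \<in> character_points" by simp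
    have "(norm (fourier (continuous_dist E t \<sigma>) x))\<^sup>2 = exp (- (2 * t) * (1 - Re (eigenvalue x)))"
      using x by (simp add: fourier_continuous_dist[OF _ assms(2)] character_points_dual norm_mult
          power2_eq_square exp_add[symmetric] algebra_simps)
    also have "2 * t * (8 * (norm x)\<^sup>2 / CARD('a option)) \<le> 2 * t * (1 - Re (eigenvalue x))"
      using Re_eigenvalue_le[OF x] \<open>t \<ge> 0\<close> by (intro mult_left_mono) auto
    hence "exp (- (2 * t) * (1 - Re (eigenvalue x))) \<le> exp (- (16 * t / CARD('a option) * (norm x)\<^sup>2))"
      by (simp add: mult_ac)
    also have "\<dots> \<le> exp (- pi * r\<^sup>2 * (norm x)\<^sup>2)"
      using mult_right_mono[OF t16, of "(norm x)\<^sup>2"] by simp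
    finally show "(norm (fourier (continuous_dist E t \<sigma>) x))\<^sup>2 \<le> exp (- pi * r\<^sup>2 * (norm x)\<^sup>2)" .
  qed
  also have "\<dots> \<le> gaussian_sum (image_lattice \<Delta>) r"
    by (rule sum_le_gaussian_sum[OF r(1), where f = "\<lambda>x. x"])
      (auto simp: finite_character_points dual_lattice_reduced character_points_dual)
  finally show ?thesis using r(2) by simp
qed

section \<open>The full Laplacian and the bound in discrete time\<close>

abbreviation \<Delta>' where "\<Delta>' \<equiv> full_laplacian E"

text \<open>Solve the reduced system off the sink. At the sink both sides equal minus the sum of the
  other coordinates, by \<open>sum_laplacian\<close> and the assumption.\<close>

lemma range_full_laplacian:
  assumes "(\<Sum>v\<in>UNIV. y $ v) = 0"
  shows "y \<in> range ((*v) \<Delta>')"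
proof (rule range_eqI)
  let ?x = "matrix_inv \<Delta> *v (\<chi> a. y $ Some a)"
  let ?X = "case_option 0 (($) ?x)"
  have some: "laplacian E ?X (Some a) = y $ Some a" for a
    by (simp add: reduced_laplacian_mult[symmetric] reduced_laplacian_inverse)
  have "laplacian E ?X v = y $ v" for v
  proof (cases v)
    case None
    have "laplacian E ?X None = - (\<Sum>a\<in>UNIV. y $ Some a)"
      using sum_laplacian[of ?X] by (simp add: sum_option some)
    also have "\<dots> = y $ None" using assms by (simp add: sum_option)
    finally show ?thesis using None by simp
  qed (simp add: some)
  moreover have "($) (vec_lambda ?X) = ?X" by auto
  ultimately show "y = \<Delta>' *v (\<chi> v. ?X v)"
    by (simp only: vec_eq_iff full_laplacian_mult) simp
qed

text \<open>The dual of \<open>\<Delta>'\<int>\<^sup>n\<close> consists of the projections to the sum-zero hyperplane of the points of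
  \<open>dual_points\<close>, extended by \<open>0\<close> at the sink and translated by integer vectors.\<close>

lemma dual_lattice_fullI:
  assumes "x \<in> dual_points" "(\<Sum>v\<in>UNIV. y $ v) = 0"
    and c: "\<And>v. y $ v - case_option 0 (($) x) v - c \<in> \<int>"
  shows "y \<in> dual_lattice (image_lattice \<Delta>')"
proof -
  let ?X = "case_option 0 (($) x)"
  have "laplacian E (($) y) v \<in> \<int>" for v
  proof -
    have some: "laplacian E ?X (Some a) \<in> \<int>" for a
      using assms(1) by (simp add: reduced_laplacian_mult[symmetric] dual_points_def)
    have "laplacian E ?X None = - (\<Sum>a\<in>UNIV. laplacian E ?X (Some a))"
      using sum_laplacian[of ?X] by (simp add: sum_option)
    hence X: "laplacian E ?X v \<in> \<int>"
      using some by (cases v) (auto intro!: Ints_minus Ints_sum)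
    \<comment> \<open>The constant \<open>c\<close> cancels in edge differences, so the two
      Laplacians differ by an integer.\<close>
    have "laplacian E (($) y) v = laplacian E ?X v
        + (\<Sum>u | E v u. (y $ v - ?X v - c) - (y $ u - ?X u - c))"
      by (simp add: laplacian_def sum.distrib[symmetric])
    also have "\<dots> \<in> \<int>"
      by (intro Ints_add X Ints_sum Ints_diff[OF c c])
    finally show ?thesis .
  qed
  thus ?thesis
    using range_full_laplacian[OF assms(2)]
    by (simp add: dual_lattice_image_lattice vector_full_laplacian full_laplacian_mult)
qed

text \<open>The modulus of the eigenvalue, unlike its real part, is insensitive to a common phase,
  hence the free constant \<open>c\<close>. Keeping \<open>c\<close> in the conclusion lets
  \<open>x\<close> be recovered from \<open>y\<close>.\<close>

lemma norm_eigenvalue_le: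
  assumes "x \<in> dual_points"
  obtains y c where "y \<in> dual_lattice (image_lattice \<Delta>')"
    "\<And>v. y $ v - case_option 0 (($) x) v - c \<in> \<int>"
    "norm (eigenvalue x) \<le> exp (- 8 * (norm y)\<^sup>2 / CARD('a option))"
proof -
  let ?X = "case_option 0 (($) x)"
  \<comment> \<open>Rotating by \<open>\<theta>\<close> makes the sum of the \<open>turn (?X v)\<close> real and nonnegative.\<close>
  define z where "z = (\<Sum>v\<in>UNIV. turn (?X v))"
  define \<theta> where "\<theta> = Arg z / (2 * pi)"
  define y' where "y' = frac_vec (\<chi> v. ?X v - \<theta>)"
  define m where "m = (\<Sum>v\<in>UNIV. y' $ v) / CARD('a option)"
  define y where "y = (\<chi> v. y' $ v - m)"
  have y': "y' $ v - ?X v + \<theta> \<in> \<int>" for v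
    using diff_frac_vec[of "\<chi> v. ?X v - \<theta>" v]
    by (simp add: y'_def frac_vec_def)
  have sum_y: "(\<Sum>v\<in>UNIV. y $ v) = 0"
    using card_vertices_pos by (simp add: y_def sum_subtractf m_def del: card_option)
  have c: "y $ v - ?X v - (- \<theta> - m) \<in> \<int>" for v
    using y'[of v] by (simp add: y_def algebra_simps)
  have "z = cmod z * turn \<theta>"
    using rcis_cmod_Arg[of z] by (simp add: turn_def \<theta>_def rcis_def)
  hence "complex_of_real (cmod z) = z * cnj (turn \<theta>)"
    using complex_norm_square[of "turn \<theta>"] by (metis mult.assoc mult.right_neutral norm_turn of_real_1 one_power2)
  also have "\<dots> = (\<Sum>v\<in>UNIV. turn (?X v - \<theta>))"
    by (simp add: z_def turn_diff sum_distrib_right)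
  also have "\<dots> = (\<Sum>v\<in>UNIV. turn (y' $ v))"
  proof (intro sum.cong refl turn_eqI)
    show "?X v - \<theta> - y' $ v \<in> \<int>" for v
      using Ints_minus[OF y'[of v]] by (simp add: algebra_simps)
  qed
  finally have "cmod z = Re (\<Sum>v\<in>UNIV. turn (y' $ v))"
    by (metis Re_complex_of_real)
  also have "\<dots> = (\<Sum>v\<in>UNIV. cos (2 * pi * y' $ v))"
    by (simp add: turn_def)
  also have "\<dots> \<le> (\<Sum>v\<in>UNIV. 1 - 8 * (y' $ v)\<^sup>2)"
  proof (intro sum_mono cos_2pi_le)
    fix v
    show "\<bar>y' $ v\<bar> \<le> 1 / 2"
      using frac_vec_bounds[where v = v and x = "\<chi> v. ?X v - \<theta>"] unfolding y'_def by arith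
  qed
  also have "\<dots> = CARD('a option) - 8 * (\<Sum>v\<in>UNIV. (y' $ v)\<^sup>2)"
    by (simp add: sum_subtractf sum_distrib_left[symmetric])
  \<comment> \<open>Orthogonal splitting into the mean-free part \<open>y\<close> and the mean
    \<open>m\<close>; dropping the term in \<open>m\<close> only weakens the bound.\<close>
  also have "(\<Sum>v\<in>UNIV. (y' $ v)\<^sup>2) = (norm y)\<^sup>2 + CARD('a option) * m\<^sup>2"
  proof -
    have "(\<Sum>v\<in>UNIV. (y' $ v)\<^sup>2) = (\<Sum>v\<in>UNIV. (y $ v)\<^sup>2 + 2 * m * y $ v + m\<^sup>2)"
      by (simp add: y_def power2_eq_square algebra_simps)
    also have "\<dots> = (\<Sum>v\<in>UNIV. (y $ v)\<^sup>2) + CARD('a option) * m\<^sup>2"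
      by (simp add: sum.distrib sum_distrib_left[symmetric] sum_y del: card_option)
    finally show ?thesis by (simp add: norm_vec_def L2_set_def sum_nonneg del: card_option)
  qed
  finally have "cmod z \<le> CARD('a option) - 8 * (norm y)\<^sup>2"
    by (rule order_trans) simp
  hence "cmod z / CARD('a option) \<le> (CARD('a option) - 8 * (norm y)\<^sup>2) / CARD('a option)"
    by (intro divide_right_mono) auto
  also have "\<dots> = 1 + - 8 * (norm y)\<^sup>2 / CARD('a option)"
    using card_vertices_pos by (simp add: diff_divide_distrib del: card_option)
  also have "\<dots> \<le> exp (- 8 * (norm y)\<^sup>2 / CARD('a option))"
    by (rule exp_ge_add_one_self)
  finally have "norm (eigenvalue x) \<le> exp (- 8 * (norm y)\<^sup>2 / CARD('a option))"
    by (simp add: eigenvalue_def z_def norm_divide del: card_option)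
  with that c dual_lattice_fullI[OF assms sum_y c] show thesis by blast
qed

theorem discrete_mixing:
  assumes "\<epsilon> > 0" "\<sigma> \<in> recurrent E"
    and t: "pi / 16 * CARD('a option) * (smoothing_parameter \<epsilon> (image_lattice \<Delta>'))\<^sup>2 \<le> real t"
  shows "(l2_dist (recurrent E) (discrete_dist E t \<sigma>) (uniform_dist E))\<^sup>2 \<le> \<epsilon>"
proof -
  define r where "r = smoothing_parameter \<epsilon> (image_lattice \<Delta>')"
  fix a :: 'a
  \<comment> \<open>The unit vector at \<open>a\<close> minus its mean: a dual vector that is
    nonzero because of its sink coordinate.\<close>
  define y0 :: "real^'a option" where "y0 = (\<chi> v. case_option 0 (($) (axis a 1)) v - 1 / CARD('a option))"
  have "y0 \<in> dual_lattice (image_lattice \<Delta>')"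
  proof (rule dual_lattice_fullI)
    show "axis a 1 \<in> dual_points" by (intro dual_points_integer) (simp add: axis_def)
    show "(\<Sum>v\<in>UNIV. y0 $ v) = 0"
      using card_vertices_pos by (simp add: y0_def sum_subtractf sum_option axis_def del: card_option)
    show "y0 $ v - case_option 0 (($) (axis a 1)) v - (- 1 / CARD('a option)) \<in> \<int>" for v
      by (simp add: y0_def)
  qed
  moreover have "y0 $ None \<noteq> 0" using card_vertices_pos by (simp add: y0_def del: card_option)
  hence "y0 \<noteq> 0" by auto
  ultimately have r: "r > 0" "gaussian_sum (image_lattice \<Delta>') r = \<epsilon>"
    unfolding r_def using assms(1) by (auto intro!: smoothing_parameter_image_lattice)
  have t16: "pi * r\<^sup>2 \<le> 16 * t / CARD('a option)"
    using t[folded r_def] card_vertices_pos by (simp add: field_simps del: card_option)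
  have "\<forall>x\<in>character_points. \<exists>y c. y \<in> dual_lattice (image_lattice \<Delta>')
      \<and> (\<forall>v. y $ v - case_option 0 (($) x) v - c \<in> \<int>)
      \<and> norm (eigenvalue x) \<le> exp (- 8 * (norm y)\<^sup>2 / CARD('a option))"
    using norm_eigenvalue_le character_points_dual by metis
  then obtain f c where f: "\<And>x. x \<in> character_points \<Longrightarrow> f x \<in> dual_lattice (image_lattice \<Delta>')"
      and c: "\<And>x v. x \<in> character_points \<Longrightarrow> f x $ v - case_option 0 (($) x) v - c x \<in> \<int>"
      and le: "\<And>x. x \<in> character_points \<Longrightarrow> norm (eigenvalue x) \<le> exp (- 8 * (norm (f x))\<^sup>2 / CARD('a option))"
    by metis
  have determined: "x = x'"
    if x: "x \<in> character_points" "x' \<in> character_points"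
      and y: "\<And>v. y $ v - case_option 0 (($) x) v - b \<in> \<int>" "\<And>v. y $ v - case_option 0 (($) x') v - b' \<in> \<int>"
    for x x' b b' and y :: "real^'a option"
  proof -
    have diff: "case_option 0 (($) x') v - case_option 0 (($) x) v + (b' - b) \<in> \<int>" for v
      using Ints_diff[OF y(1)[of v] y(2)[of v]] by (simp add: algebra_simps)
    \<comment> \<open>Both extended points vanish at the sink, so this coordinate isolates the
      constants.\<close>
    have "b' - b \<in> \<int>" using diff[of None] by simp
    from Ints_diff[OF diff[of "Some _"] this] have "(x' - x) $ v \<in> \<int>" for v by simp
    hence "frac_vec x' = frac_vec x" by (rule frac_vec_eqI)
    thus ?thesis using x by (simp add: character_points_def frac_vec_id)
  qed
  have zero: "0 \<in> character_points"
    by (simp add: character_points_def dual_points_integer)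
  have "(l2_dist (recurrent E) (discrete_dist E t \<sigma>) (uniform_dist E))\<^sup>2
      \<le> (\<Sum>x\<in>character_points - {0}. (norm (fourier (discrete_dist E t \<sigma>) x))\<^sup>2)"
    by (rule l2_dist_uniform_le[OF assms(2)])
      (simp add: fourier_discrete_dist[OF _ assms(2)] dual_points_integer eigenvalue_0)
  also have "\<dots> \<le> (\<Sum>x\<in>character_points - {0}. exp (- pi * r\<^sup>2 * (norm (f x))\<^sup>2))"
  proof (rule sum_mono)
    fix x assume "x \<in> character_points - {0}"
    hence x: "x \<in> character_points" by simp
    have "(norm (fourier (discrete_dist E t \<sigma>) x))\<^sup>2 = norm (eigenvalue x) ^ (2 * t)"
      using x by (simp add: fourier_discrete_dist[OF _ assms(2)] character_points_dual norm_mult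
          norm_power power_mult[symmetric] mult.commute)
    also have "\<dots> \<le> exp (- 8 * (norm (f x))\<^sup>2 / CARD('a option)) ^ (2 * t)"
      by (intro power_mono le x) auto
    also have "\<dots> = exp (- (16 * t / CARD('a option) * (norm (f x))\<^sup>2))"
      by (simp add: exp_of_nat_mult[symmetric])
    also have "\<dots> \<le> exp (- pi * r\<^sup>2 * (norm (f x))\<^sup>2)"
      using mult_right_mono[OF t16, of "(norm (f x))\<^sup>2"] by simp
    finally show "(norm (fourier (discrete_dist E t \<sigma>) x))\<^sup>2 \<le> exp (- pi * r\<^sup>2 * (norm (f x))\<^sup>2)" .
  qed
  also have "\<dots> \<le> gaussian_sum (image_lattice \<Delta>') r"
  proof (rule sum_le_gaussian_sum[OF r(1)])
    show "inj_on f (character_points - {0})"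
    proof (rule inj_onI)
      fix x x' assume x: "x \<in> character_points - {0}" "x' \<in> character_points - {0}" and "f x = f x'"
      thus "x = x'" using c[of x] c[of x'] by (intro determined[of x x' "f x" "c x" "c x'"]) auto
    qed
    show "f ` (character_points - {0}) \<subseteq> dual_lattice (image_lattice \<Delta>') - {0}"
    proof (rule image_subsetI)
      fix x assume "x \<in> character_points - {0}"
      hence x: "x \<in> character_points" "x \<noteq> 0" by auto
      \<comment> \<open>The zero vector already belongs to the trivial character with constant 0,
        and \<open>determined\<close> allows no other.\<close>
      have "f x \<noteq> 0"
      proof
        assume fx: "f x = 0"
        have "x = 0"
        proof (rule determined[OF x(1) zero, of "f x" "c x" 0])
          show "f x $ v - case_option 0 (($) (0 :: real^'a)) v - 0 \<in> \<int>" for v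
            by (cases v) (simp_all add: fx)
        qed (rule c[OF x(1)])
        thus False using x by simp
      qed
      thus "f x \<in> dual_lattice (image_lattice \<Delta>') - {0}" using f[OF x(1)] by simp
    qed
  qed (simp add: finite_character_points)
  finally show ?thesis using r(2) by simp
qed

end

theorem theorem1p2:
  fixes E :: "'a::finite option \<Rightarrow> 'a option \<Rightarrow> bool"
    and \<epsilon> :: real
    and \<sigma> :: "'a config"
  assumes "simple_graph E"
    and "graph_connected E"
    and "\<not> is_tree E"
    and "\<epsilon> > 0"
    and "\<sigma> \<in> recurrent E"
  shows "(\<forall>t::real. t \<ge> pi / 16 * real CARD('a option) *
              (smoothing_parameter \<epsilon> (image_lattice (reduced_laplacian E)))\<^sup>2 \<longrightarrow>
            (l2_dist (recurrent E) (continuous_dist E t \<sigma>) (uniform_dist E))\<^sup>2 \<le> \<epsilon>) \<and>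
         (\<forall>t::nat. real t \<ge> pi / 16 * real CARD('a option) *
              (smoothing_parameter \<epsilon> (image_lattice (full_laplacian E)))\<^sup>2 \<longrightarrow>
            (l2_dist (recurrent E) (discrete_dist E t \<sigma>) (uniform_dist E))\<^sup>2 \<le> \<epsilon>)"
proof -
  interpret sandpile_graph E using assms by unfold_locales
  show ?thesis using continuous_mixing discrete_mixing assms(4,5) by blast
qed

end
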